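(* The set $(M\setminus L)\cap(3.7,3.71)$ has Hausdorff dimension strictly greater than $0.53128$. In particular, $(M\setminus L)\cap(3.7,3.71)\neq\emptyset$.
   Context: For a bi-infinite sequence $a=(a_n)_{n\in\mathbb{Z}}$ of positive integers, put $\lambda_i(a)=[a_i;a_{i+1},a_{i+2},\dots]+[0;a_{i-1},a_{i-2},\dots]$ (regular continued fractions). The Markov value is $m(a)=\sup_{n\in\mathbb{Z}}\lambda_n(a)$ and the Lagrange value is $\ell(a)=\limsup_{n\to+\infty}\lambda_n(a)$. The Markov spectrum $M$ is the set of finite Markov values and the Lagrange spectrum $L$ is the set of finite Lagrange values. (Equivalently, $L=\{\limsup_{p,q\to\infty}1/|q(q\alpha-p)|<\infty:\alpha\in\mathbb{R}\setminus\mathbb{Q}\}$ and $M=\{1/\inf_{(x,y)\in\mathbb{Z}^2\setminus\{0\}}|q(x,y)|<\infty\}$ over real indefinite binary quadratic forms $q$ of discriminant $1$.) *)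

theory Defs
  imports "HOL-Analysis.Analysis"
begin

section \<open>Hausdorff dimension\<close>

text \<open>
  The conventions are \<open>diam({})^s = 0\<close> and \<open>0^0 = 1\<close> for nonempty sets, so the
  zero-dimensional measure counts points; \<open>powr\<close> alone would give \<open>0 powr 0 = 0\<close>.
\<close>

definition diam_power :: "real \<Rightarrow> 'a::metric_space set \<Rightarrow> ennreal" where
  "diam_power s U =
     (if U = {} then 0 else if s = 0 then 1 else ennreal (diameter U powr s))"

text \<open>
  Boundedness is required because \<^const>\<open>diameter\<close> is real-valued and unspecified on
  unbounded sets. Finite covers are included, since the \<open>U i\<close> may be empty.
\<close>

definition hausdorff_premeasure :: "real \<Rightarrow> real \<Rightarrow> 'a::metric_space set \<Rightarrow> ennreal" where
  "hausdorff_premeasure s \<delta> A =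
     (INF U \<in> {U :: nat \<Rightarrow> 'a set. A \<subseteq> (\<Union>i. U i) \<and> (\<forall>i. bounded (U i) \<and> diameter (U i) \<le> \<delta>)}.
        \<Sum>i. diam_power s (U i))"

definition hausdorff_outer_measure :: "real \<Rightarrow> 'a::metric_space set \<Rightarrow> ennreal" where
  "hausdorff_outer_measure s A = (SUP \<delta> \<in> {0<..}. hausdorff_premeasure s \<delta> A)"

definition hausdorff_dimension :: "'a::metric_space set \<Rightarrow> ereal" where
  "hausdorff_dimension A = (INF s \<in> {s. 0 \<le> s \<and> hausdorff_outer_measure s A = 0}. ereal s)"


section \<open>Continued fractions\<close>

text \<open>\<open>cf_convergent n c\<close> is \<open>[c 0; c 1, \<dots>, c n]\<close>.\<close>

primrec cf_convergent :: "nat \<Rightarrow> (nat \<Rightarrow> nat) \<Rightarrow> real" where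
  "cf_convergent 0 c = real (c 0)"
| "cf_convergent (Suc n) c = real (c 0) + 1 / cf_convergent n (\<lambda>k. c (Suc k))"

text \<open>The limit exists whenever \<open>c k > 0\<close> for all \<open>k \<ge> 1\<close>, the only case used below.\<close>

definition cf_value :: "(nat \<Rightarrow> nat) \<Rightarrow> real" where
  "cf_value c = lim (\<lambda>n. cf_convergent n c)"


section \<open>The Markov and Lagrange spectra\<close>

definition cf_lambda :: "(int \<Rightarrow> nat) \<Rightarrow> int \<Rightarrow> real" where
  "cf_lambda a i =
     cf_value (\<lambda>k. a (i + int k)) + cf_value (\<lambda>k. if k = 0 then 0 else a (i - int k))"

definition markov_value :: "(int \<Rightarrow> nat) \<Rightarrow> ereal" where
  "markov_value a = (SUP n. ereal (cf_lambda a n))"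

definition lagrange_value :: "(int \<Rightarrow> nat) \<Rightarrow> ereal" where
  "lagrange_value a = limsup (\<lambda>n. ereal (cf_lambda a (int n)))"

definition markov_spectrum :: "real set" where
  "markov_spectrum = {x. \<exists>a. (\<forall>n. a n > 0) \<and> markov_value a = ereal x}"

definition lagrange_spectrum :: "real set" where
  "lagrange_spectrum = {x. \<exists>a. (\<forall>n. a n > 0) \<and> lagrange_value a = ereal x}"

end

theory Submission
  imports Defs
begin

text \<open>
  The periodic sequence with period \<open>3222123\<close> of odd length 7 has Markov value
  \<open>j = 3.70969985967967\<dots>\<close>. Suppose all values of a sequence near some position are below
  \<open>T\<^sub>1 = 3.709699859751\<close> while the value at that position exceeds
  \<open>T\<^sub>0 = 3.70969985975\<close>, slightly above \<open>j\<close>. A finite search shows that, up to reversal, the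
  surrounding digits agree with the periodic sequence and that this pattern repeats itself
  indefinitely to the left, as long as the values stay below \<open>T\<^sub>1\<close>. If this happens at infinitely
  many positions, the sequence is eventually periodic, and its values are eventually below \<open>T\<^sub>0\<close>.
  So the Lagrange spectrum does not meet \<open>(T\<^sub>0, T\<^sub>1)\<close>. To the right the pattern can be left: after
  a suitable transition word the sequence may continue with arbitrary digits 1 and 2, and the
  Markov value, attained just before the transition, lies in \<open>(T\<^sub>0, T\<^sub>1)\<close>.

  This embeds the Cantor set of continued fractions with digits 1 and 2 into the difference of the
  spectra by a map with Lipschitz inverse. Its dimension is \<open>0.5312805\<dots>\<close>; for the lower bound
  \<open>s = 552/1039\<close> a positive polynomial \<open>f\<close> is exhibited with
  \<open>f x \<le> (1 + x) powr (- 2 * s) * f (1 / (1 + x)) + (2 + x) powr (- 2 * s) * f (1 / (2 + x))\<close>.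
  Iterating this inequality distributes mass on the words of length \<open>n\<close> such that every cylinder
  receives at most a constant times its diameter to the power \<open>s\<close>, and compactness of the sequence
  space turns this into a lower bound for all countable covers.
\<close>

section \<open>Convergence of continued fractions\<close>

lemma cf_convergent_ge_1:
  assumes "\<forall>k. c k > 0"
  shows "cf_convergent n c \<ge> 1"
  using assms
proof (induction n arbitrary: c)
  case 0
  then show ?case by (simp add: Suc_leI)
next
  case (Suc n)
  have "cf_convergent n (\<lambda>k. c (Suc k)) \<ge> 1" using Suc.prems by (intro Suc.IH) simp
  moreover have "real (c 0) \<ge> 1" using Suc.prems by (simp add: Suc_leI)
  ultimately show ?case by (simp add: add_increasing2)
qed

lemma abs_diff_inverse_le:
  fixes x y :: real
  assumes "x \<ge> 1" "y \<ge> 1"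
  shows "\<bar>1/x - 1/y\<bar> \<le> 1"
proof -
  have "0 \<le> 1/x" "1/x \<le> 1" "0 \<le> 1/y" "1/y \<le> 1" using assms by auto
  then show ?thesis by linarith
qed

text \<open>The difference equals \<open>(x - y) / ((a*x + 1) * (a*y + 1))\<close> with both factors
  at least 2. A single step has no uniform contraction factor near 1, so two are combined.\<close>

lemma cf_two_step_contraction:
  fixes a b x y :: real
  assumes "a \<ge> 1" "x \<ge> 1" "y \<ge> 1"
  shows "\<bar>(b + 1/(a + 1/x)) - (b + 1/(a + 1/y))\<bar> \<le> \<bar>x - y\<bar> / 4"
proof -
  have eq: "(b + 1/(a + 1/x)) - (b + 1/(a + 1/y)) = (x - y) / ((a*x + 1) * (a*y + 1))"
  proof -
    have "a * x + 1 > 0" "a * y + 1 > 0" using assms by (auto intro!: add_nonneg_pos)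
    moreover have "1/(a + 1/x) = x / (a*x + 1)" "1/(a + 1/y) = y / (a*y + 1)"
      using assms by (simp_all add: add_divide_eq_iff)
    ultimately show ?thesis by (simp only: add_diff_cancel_left) (simp add: field_simps)
  qed
  have "a * x \<ge> 1" "a * y \<ge> 1" using assms mult_mono[of 1 a 1 x] mult_mono[of 1 a 1 y] by auto
  then have "(a*x + 1) * (a*y + 1) \<ge> 2 * 2" by (intro mult_mono) auto
  then have "\<bar>x - y\<bar> / ((a*x + 1) * (a*y + 1)) \<le> \<bar>x - y\<bar> / 4"
    by (intro divide_left_mono) auto
  moreover have "\<bar>(a*x + 1) * (a*y + 1)\<bar> = (a*x + 1) * (a*y + 1)"
    using \<open>(a*x + 1) * (a*y + 1) \<ge> 2 * 2\<close> by linarith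
  ultimately show ?thesis by (simp only: eq abs_divide)
qed

text \<open>Induction two digits at a time. The \<open>+ 1\<close> makes both base convergents of
  the form \<open>c 0 + 1/y\<close> with \<open>y \<ge> 1\<close>, so they differ by at most
  1.\<close>

lemma cf_convergent_cauchy_bound:
  assumes "\<forall>k. c k > 0" "n \<ge> 2 * N + 1" "m \<ge> 2 * N + 1"
  shows "\<bar>cf_convergent n c - cf_convergent m c\<bar> \<le> (1/4)^N"
  using assms
proof (induction N arbitrary: c n m)
  case 0
  obtain n' m' where nm: "n = Suc n'" "m = Suc m'"
    using 0(2,3) by (metis Suc_le_D add.commute mult_0_right plus_1_eq_Suc add_0_right)
  have "cf_convergent n' (\<lambda>k. c (Suc k)) \<ge> 1" "cf_convergent m' (\<lambda>k. c (Suc k)) \<ge> 1"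
    using 0(1) by (auto intro: cf_convergent_ge_1)
  from abs_diff_inverse_le[OF this] show ?case by (simp add: nm)
next
  case (Suc N)
  obtain n' m' where nm: "n = Suc (Suc n')" "m = Suc (Suc m')" "n' \<ge> 2*N+1" "m' \<ge> 2*N+1"
    using Suc(3,4) by (intro that[of "n-2" "m-2"]) auto
  let ?d = "\<lambda>k. c (Suc (Suc k))"
  have ge: "cf_convergent n' ?d \<ge> 1" "cf_convergent m' ?d \<ge> 1"
    using Suc(2) by (auto intro: cf_convergent_ge_1)
  have a: "real (c (Suc 0)) \<ge> 1" using Suc.prems(1) by (simp add: Suc_leI)
  have "\<bar>cf_convergent n c - cf_convergent m c\<bar> \<le> \<bar>cf_convergent n' ?d - cf_convergent m' ?d\<bar> / 4"
    using cf_two_step_contraction[OF a ge, of "real (c 0)"] by (simp add: nm)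
  also have "\<dots> \<le> (1/4)^N / 4"
    using Suc.IH[of ?d n' m'] Suc(2) nm by (intro divide_right_mono) auto
  finally show ?case by simp
qed

lemma cf_convergent_convergent:
  assumes "\<forall>k. c k > 0"
  shows "convergent (\<lambda>n. cf_convergent n c)"
proof -
  have "Cauchy (\<lambda>n. cf_convergent n c)"
  proof (rule metric_CauchyI)
    fix e :: real assume "e > 0"
    then obtain N where N: "(1/4::real)^N < e"
      using real_arch_pow_inv[of e "1/4"] by auto
    have "dist (cf_convergent m c) (cf_convergent n c) < e" if "m \<ge> 2*N+1" "n \<ge> 2*N+1" for m n
      using cf_convergent_cauchy_bound[OF assms that] N by (simp add: dist_real_def)
    then show "\<exists>M. \<forall>m\<ge>M. \<forall>n\<ge>M. dist (cf_convergent m c) (cf_convergent n c) < e" by blast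
  qed
  then show ?thesis by (simp add: Cauchy_convergent_iff)
qed

lemma cf_convergent_tendsto:
  assumes "\<forall>k. c k > 0"
  shows "(\<lambda>n. cf_convergent n c) \<longlonglongrightarrow> cf_value c"
  using cf_convergent_convergent[OF assms] by (simp add: cf_value_def convergent_LIMSEQ_iff)

lemma cf_value_ge_1:
  assumes "\<forall>k. c k > 0"
  shows "cf_value c \<ge> 1"
  using LIMSEQ_le_const[OF cf_convergent_tendsto[OF assms]] cf_convergent_ge_1[OF assms] by blast

text \<open>The head may vanish, as it does in the left half of \<^const>\<open>cf_lambda\<close>.\<close>

lemma cf_value_rec:
  assumes "\<forall>k. c (Suc k) > 0"
  shows "cf_value c = real (c 0) + 1 / cf_value (\<lambda>k. c (Suc k))"
proof -
  let ?d = "\<lambda>k. c (Suc k)"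
  have "(\<lambda>n. real (c 0) + 1 / cf_convergent n ?d) \<longlonglongrightarrow> real (c 0) + 1 / cf_value ?d"
    using cf_value_ge_1[of ?d] assms cf_convergent_tendsto[of ?d] by (intro tendsto_intros) auto
  then have "(\<lambda>n. cf_convergent (Suc n) c) \<longlonglongrightarrow> real (c 0) + 1 / cf_value ?d" by simp
  then have "(\<lambda>n. cf_convergent n c) \<longlonglongrightarrow> real (c 0) + 1 / cf_value ?d"
    by (rule LIMSEQ_imp_Suc)
  then show ?thesis unfolding cf_value_def[of c] by (simp add: limI)
qed

lemma cf_value_gt_head:
  assumes "\<forall>k. c k > 0"
  shows "real (c 0) < cf_value c"
proof -
  have "cf_value (\<lambda>k. c (Suc k)) \<ge> 1" using assms by (intro cf_value_ge_1) auto
  moreover have "cf_value c = real (c 0) + 1 / cf_value (\<lambda>k. c (Suc k))"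
    using assms by (intro cf_value_rec) auto
  ultimately show ?thesis by simp
qed

lemma cf_value_gt_1:
  assumes "\<forall>k. c k > 0"
  shows "cf_value c > 1"
  using cf_value_gt_head[OF assms] assms[rule_format, of 0] by linarith

lemma cf_value_less:
  assumes "\<forall>k. c k > 0"
  shows "cf_value c < real (c 0) + 1"
proof -
  have "cf_value (\<lambda>k. c (Suc k)) > 1" using assms by (intro cf_value_gt_1) auto
  moreover have "cf_value c = real (c 0) + 1 / cf_value (\<lambda>k. c (Suc k))"
    using assms by (intro cf_value_rec) auto
  ultimately show ?thesis by simp
qed

section \<open>The two one-sided expansions at a position\<close>

definition cf_right :: "(int \<Rightarrow> nat) \<Rightarrow> int \<Rightarrow> real" where
  "cf_right a n = cf_value (\<lambda>k. a (n + 1 + int k))"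

definition cf_left :: "(int \<Rightarrow> nat) \<Rightarrow> int \<Rightarrow> real" where
  "cf_left a n = cf_value (\<lambda>k. a (n - 1 - int k))"

lemma cf_left_reverse: "cf_left (\<lambda>i. a (- i)) n = cf_right a (- n)"
  unfolding cf_left_def cf_right_def by (intro arg_cong[of _ _ cf_value] ext) (simp add: algebra_simps)

lemma cf_right_reverse: "cf_right (\<lambda>i. a (- i)) n = cf_left a (- n)"
  unfolding cf_left_def cf_right_def
  by (intro arg_cong[of _ _ cf_value] ext arg_cong[of _ _ a]) simp

lemma cf_right_gt_1: "\<forall>i. a i > 0 \<Longrightarrow> cf_right a n > 1"
  unfolding cf_right_def by (rule cf_value_gt_1) auto

lemma cf_left_gt_1: "\<forall>i. a i > 0 \<Longrightarrow> cf_left a n > 1"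
  unfolding cf_left_def by (rule cf_value_gt_1) auto

lemma cf_right_rec:
  assumes "\<forall>i. a i > 0"
  shows "cf_right a n = real (a (n + 1)) + 1 / cf_right a (n + 1)"
proof -
  have "(\<lambda>k. a (n + 1 + int (Suc k))) = (\<lambda>k. a (n + 1 + 1 + int k))" by (simp add: algebra_simps)
  then show ?thesis unfolding cf_right_def using assms by (subst cf_value_rec) auto
qed

lemma cf_right_less:
  assumes "\<forall>i. a i > 0" "a (n + 1) \<le> d"
  shows "cf_right a n < real d + 1"
  using cf_value_less[of "\<lambda>k. a (n + 1 + int k)"] assms unfolding cf_right_def by auto

lemma cf_lambda_eq:
  assumes "\<forall>i. a i > 0"
  shows "cf_lambda a n = real (a n) + 1 / cf_right a n + 1 / cf_left a n"
proof -
  have "(\<lambda>k. a (n + int (Suc k))) = (\<lambda>k. a (n + 1 + int k))"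
       "(\<lambda>k. if Suc k = 0 then 0 else a (n - int (Suc k))) = (\<lambda>k. a (n - 1 - int k))"
    by (simp_all add: algebra_simps)
  then have "cf_value (\<lambda>k. a (n + int k)) = real (a n) + 1 / cf_right a n"
      "cf_value (\<lambda>k. if k = 0 then 0 else a (n - int k)) = 1 / cf_left a n"
    unfolding cf_right_def cf_left_def using assms by (subst cf_value_rec, auto)+
  then show ?thesis by (simp add: cf_lambda_def)
qed

lemma cf_lambda_reverse:
  assumes "\<forall>i. a i > 0"
  shows "cf_lambda (\<lambda>i. a (- i)) n = cf_lambda a (- n)"
  using assms by (simp add: cf_lambda_eq cf_left_reverse cf_right_reverse)

lemma cf_lambda_gt_digit:
  assumes "\<forall>i. a i > 0"
  shows "cf_lambda a n > real (a n)"
  using cf_right_gt_1[of a n] cf_left_gt_1[of a n] assms by (simp add: cf_lambda_eq add_pos_pos)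

section \<open>Forcing digits by bounds on the values\<close>

primrec digits_right :: "(int \<Rightarrow> nat) \<Rightarrow> int \<Rightarrow> int list \<Rightarrow> bool" where
  "digits_right a n [] \<longleftrightarrow> True"
| "digits_right a n (d # ds) \<longleftrightarrow> int (a (n + 1)) = d \<and> digits_right a (n + 1) ds"

primrec digits_left :: "(int \<Rightarrow> nat) \<Rightarrow> int \<Rightarrow> int list \<Rightarrow> bool" where
  "digits_left a n [] \<longleftrightarrow> True"
| "digits_left a n (d # ds) \<longleftrightarrow> int (a (n - 1)) = d \<and> digits_left a (n - 1) ds"

lemma digits_left_reverse: "digits_left (\<lambda>i. a (- i)) n ds \<longleftrightarrow> digits_right a (- n) ds"
proof (induction ds arbitrary: n)
  case (Cons d ds)
  have "- (n - 1) = - n + 1" by simp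
  then show ?case using Cons.IH[of "n - 1"] by (simp only: digits_left.simps digits_right.simps)
qed simp

lemma digits_right_reverse: "digits_right (\<lambda>i. a (- i)) n ds \<longleftrightarrow> digits_left a (- n) ds"
  using digits_left_reverse[of "\<lambda>i. a (- i)" "- n" ds] by simp

lemma digits_right_append:
  "digits_right a n (R @ [d]) \<longleftrightarrow> digits_right a n R \<and> int (a (n + 1 + int (length R))) = d"
  by (induction R arbitrary: n) (auto simp: add_ac)

lemma digits_left_append:
  "digits_left a n (L @ [d]) \<longleftrightarrow> digits_left a n L \<and> int (a (n - 1 - int (length L))) = d"
  by (induction L arbitrary: n) (auto simp: algebra_simps)

lemma digits_right_take: "digits_right a n R \<Longrightarrow> digits_right a n (take k R)"
  by (induction R arbitrary: n k) (auto simp: take_Cons split: nat.split)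

lemma digits_left_take: "digits_left a n R \<Longrightarrow> digits_left a n (take k R)"
  by (induction R arbitrary: n k) (auto simp: take_Cons split: nat.split)

text \<open>
  \<open>cf_bound b ds\<close> is a fraction bounding \<open>[ds; x]\<close> for every tail \<open>1 < x < 4\<close>,
  from above if \<open>b\<close> and from below otherwise.
\<close>

fun cf_bound :: "bool \<Rightarrow> int list \<Rightarrow> int \<times> int" where
  "cf_bound b [] = (if b then (4, 1) else (1, 1))"
| "cf_bound b (d # ds) = (case cf_bound (\<not> b) ds of (p, q) \<Rightarrow> (d * p + q, p))"

text \<open>Since \<open>d + 1/x\<close> decreases in \<open>x\<close>, each digit flips the side of
  the bound. The digit after \<open>ds\<close> is at most 3, which places the remaining tail between
  1 and 4.\<close>

lemma cf_bound_right:
  assumes "\<forall>i. a i > 0" "digits_right a n ds" "a (n + 1 + int (length ds)) \<le> 3"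
    and "cf_bound b ds = (p, q)"
  shows "p > 0 \<and> q > 0 \<and> (if b then cf_right a n < real_of_int p / real_of_int q
           else cf_right a n > real_of_int p / real_of_int q)"
  using assms(2-)
proof (induction ds arbitrary: n b p q)
  case Nil
  then show ?case
    using cf_right_less[of a n 3] cf_right_gt_1[of a n] assms(1) by (auto split: if_splits)
next
  case (Cons d ds)
  obtain p' q' where pq': "cf_bound (\<not> b) ds = (p', q')" by fastforce
  then have pq: "p = d * p' + q'" "q = p'" using Cons.prems(3) by auto
  have d: "int (a (n + 1)) = d" and m: "digits_right a (n + 1) ds" using Cons.prems by auto
  have d1: "d > 0" using d assms(1) by (metis of_nat_0_less_iff)
  have IH: "p' > 0 \<and> q' > 0 \<and> (if \<not> b then cf_right a (n+1) < real_of_int p' / real_of_int q'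
           else cf_right a (n+1) > real_of_int p' / real_of_int q')"
    using Cons.prems(2) by (intro Cons.IH m pq') (simp add: add_ac)
  have rec: "cf_right a n = real_of_int d + 1 / cf_right a (n + 1)"
    using cf_right_rec[OF assms(1), of n] d by simp
  have gt: "cf_right a (n + 1) > 1" using cf_right_gt_1 assms(1) by blast
  have e: "real_of_int p / real_of_int q = real_of_int d + 1 / (real_of_int p' / real_of_int q')"
    using IH by (simp add: pq field_simps)
  have "p > 0" "q > 0" using IH d1 by (auto simp: pq add_pos_pos)
  moreover have "real_of_int p' / real_of_int q' > 0" using IH by simp
  ultimately show ?case
    unfolding rec e using IH gt by (auto simp: field_simps)
qed

lemma cf_bound_left:
  assumes "\<forall>i. a i > 0" "digits_left a n ds" "a (n - 1 - int (length ds)) \<le> 3"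
    and "cf_bound b ds = (p, q)"
  shows "p > 0 \<and> q > 0 \<and> (if b then cf_left a n < real_of_int p / real_of_int q
           else cf_left a n > real_of_int p / real_of_int q)"
proof -
  have "- (- n + 1 + int (length ds)) = n - 1 - int (length ds)" by simp
  then show ?thesis
    using cf_bound_right[of "\<lambda>i. a (- i)" "- n" ds b p q] assms
    by (simp only: digits_right_reverse cf_right_reverse minus_minus) blast
qed

text \<open>
  Thresholds for \<^const>\<open>cf_lambda\<close> are integers, in units of \<open>10\<^sup>-\<^sup>1\<^sup>2\<close>.
\<close>

definition lambda_above :: "int \<Rightarrow> int list \<Rightarrow> int \<Rightarrow> int list \<Rightarrow> bool" where
  "lambda_above t L c R =
     (case cf_bound True R of (p, q) \<Rightarrow> case cf_bound True L of (p', q') \<Rightarrow>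
        t * (p * p') \<le> (c * (p * p') + q * p' + q' * p) * 1000000000000)"

definition lambda_below :: "int \<Rightarrow> int list \<Rightarrow> int \<Rightarrow> int list \<Rightarrow> bool" where
  "lambda_below t L c R =
     (case cf_bound False R of (p, q) \<Rightarrow> case cf_bound False L of (p', q') \<Rightarrow>
        (c * (p * p') + q * p' + q' * p) * 1000000000000 \<le> t * (p * p'))"

text \<open>The digits just beyond both lists are kept at most 3 because \<open>cf_bound\<close>
  presupposes tails below 4.\<close>

definition window :: "(int \<Rightarrow> nat) \<Rightarrow> int \<Rightarrow> int list \<Rightarrow> int \<Rightarrow> int list \<Rightarrow> bool" where
  "window a n L c R \<longleftrightarrow> int (a n) = c \<and> digits_left a n L \<and> digits_right a n R \<and>
     a (n - 1 - int (length L)) \<le> 3 \<and> a (n + 1 + int (length R)) \<le> 3"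

text \<open>Upper bounds of both halves bound their reciprocals from below; the integer test is the
  resulting inequality multiplied by \<open>p * p'\<close>.\<close>

lemma lambda_above_sound:
  assumes "\<forall>i. a i > 0" "window a n L c R" "lambda_above t L c R"
  shows "real_of_int t / 10^12 < cf_lambda a n"
proof -
  obtain p q p' q' where b: "cf_bound True R = (p, q)" "cf_bound True L = (p', q')" by fastforce
  have R: "p > 0" "q > 0" "cf_right a n < real_of_int p / real_of_int q"
    using cf_bound_right[OF assms(1) _ _ b(1)] assms(2) by (auto simp: window_def)
  have L: "p' > 0" "q' > 0" "cf_left a n < real_of_int p' / real_of_int q'"
    using cf_bound_left[OF assms(1) _ _ b(2)] assms(2) by (auto simp: window_def)
  have gt: "cf_right a n > 1" "cf_left a n > 1" using cf_right_gt_1 cf_left_gt_1 assms(1) by blast+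
  have "t * (p * p') \<le> (c * (p * p') + q * p' + q' * p) * 1000000000000"
    using assms(3) b by (simp add: lambda_above_def)
  then have "real_of_int (t * (p * p')) \<le> real_of_int ((c * (p * p') + q * p' + q' * p) * 1000000000000)"
    by (simp only: of_int_le_iff)
  then have "real_of_int t * (real_of_int p * real_of_int p') \<le>
     (real_of_int c * (real_of_int p * real_of_int p') + real_of_int q * real_of_int p' + real_of_int q' * real_of_int p) * 10^12"
    by simp
  then have "real_of_int t / 10^12 \<le> real_of_int c + 1 / (real_of_int p / real_of_int q) + 1 / (real_of_int p' / real_of_int q')"
    using R(1,2) L(1,2) by (simp add: field_simps)
  also have "\<dots> < real_of_int c + 1 / cf_right a n + 1 / cf_left a n"
    using R L gt by (intro add_strict_mono add_strict_left_mono divide_strict_left_mono) auto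
  also have "\<dots> = cf_lambda a n"
    using assms(2) by (auto simp: cf_lambda_eq[OF assms(1)] window_def)
  finally show ?thesis .
qed

lemma lambda_below_sound:
  assumes "\<forall>i. a i > 0" "window a n L c R" "lambda_below t L c R"
  shows "cf_lambda a n < real_of_int t / 10^12"
proof -
  obtain p q p' q' where b: "cf_bound False R = (p, q)" "cf_bound False L = (p', q')" by fastforce
  have R: "p > 0" "q > 0" "cf_right a n > real_of_int p / real_of_int q"
    using cf_bound_right[OF assms(1) _ _ b(1)] assms(2) by (auto simp: window_def)
  have L: "p' > 0" "q' > 0" "cf_left a n > real_of_int p' / real_of_int q'"
    using cf_bound_left[OF assms(1) _ _ b(2)] assms(2) by (auto simp: window_def)
  have gt: "cf_right a n > 1" "cf_left a n > 1" using cf_right_gt_1 cf_left_gt_1 assms(1) by blast+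
  have "(c * (p * p') + q * p' + q' * p) * 1000000000000 \<le> t * (p * p')"
    using assms(3) b by (simp add: lambda_below_def)
  then have "real_of_int ((c * (p * p') + q * p' + q' * p) * 1000000000000) \<le> real_of_int (t * (p * p'))"
    by (simp only: of_int_le_iff)
  then have "(real_of_int c * (real_of_int p * real_of_int p') + real_of_int q * real_of_int p' + real_of_int q' * real_of_int p) * 10^12
     \<le> real_of_int t * (real_of_int p * real_of_int p')"
    by simp
  then have *: "real_of_int c + 1 / (real_of_int p / real_of_int q) + 1 / (real_of_int p' / real_of_int q') \<le> real_of_int t / 10^12"
    using R(1,2) L(1,2) by (simp add: field_simps)
  have "cf_lambda a n = real_of_int c + 1 / cf_right a n + 1 / cf_left a n"
    using assms(2) by (auto simp: cf_lambda_eq[OF assms(1)] window_def)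
  also have "\<dots> < real_of_int c + 1 / (real_of_int p / real_of_int q) + 1 / (real_of_int p' / real_of_int q')"
    using R L gt by (intro add_strict_mono add_strict_left_mono divide_strict_left_mono) auto
  finally show ?thesis using * by linarith
qed

lemma window_reverse: "window (\<lambda>i. a (- i)) n L c R \<longleftrightarrow> window a (- n) R c L"
proof -
  have "- (n - 1 - int (length L)) = - n + 1 + int (length L)"
       "- (n + 1 + int (length R)) = - n - 1 - int (length R)" by simp_all
  then show ?thesis unfolding window_def digits_left_reverse digits_right_reverse by metis
qed

lemma window_shift: "window a n L c (r # R) \<Longrightarrow> window a (n + 1) (c # L) r R"
  by (auto simp: window_def algebra_simps)

text \<open>
  \<open>scan t L c R\<close> looks for a digit 3 in \<open>c # R\<close> at which the window forces a value above \<open>t\<close>;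
  in a sequence over \<open>{1, 2, 3}\<close> the smaller digits are never responsible for a large value.
\<close>

primrec scan :: "int \<Rightarrow> int list \<Rightarrow> int \<Rightarrow> int list \<Rightarrow> bool" where
  "scan t L c [] = (if c = 3 then lambda_above t L c [] else False)"
| "scan t L c (r # R) =
     (if (if c = 3 then lambda_above t L c (r # R) else False) then True else scan t (c # L) r R)"

lemma scan_sound:
  assumes "\<forall>i. a i > 0" "window a n L c R" "scan t L c R"
  shows "\<exists>j \<in> {n..n + int (length R)}. real_of_int t / 10^12 < cf_lambda a j"
  using assms(2,3)
proof (induction R arbitrary: n L c)
  case Nil
  then show ?case using lambda_above_sound[OF assms(1)] by (auto split: if_splits)
next
  case (Cons r R)
  show ?case
  proof (cases "lambda_above t L c (r # R)")
    case True
    then show ?thesis using lambda_above_sound[OF assms(1) Cons.prems(1)] by force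
  next
    case False
    then have "scan t (c # L) r R" using Cons.prems(2) by (auto split: if_splits)
    from Cons.IH[OF window_shift[OF Cons.prems(1)] this] obtain j
      where "j \<in> {n + 1..n + 1 + int (length R)}" "real_of_int t / 10^12 < cf_lambda a j" by blast
    then show ?thesis by (intro bexI[of _ j]) auto
  qed
qed

text \<open>\<open>scan\<close> only moves to the right, so the left half is scanned in the reversed
  sequence.\<close>

lemma scan_sound_left:
  assumes "\<forall>i. a i > 0" "window a n L c R" "scan t R c L"
  shows "\<exists>j \<in> {n - int (length L)..n}. real_of_int t / 10^12 < cf_lambda a j"
proof -
  have "window (\<lambda>i. a (- i)) (- n) R c L" using assms(2) by (simp add: window_reverse)
  from scan_sound[OF _ this assms(3)] assms(1) obtain j
    where "j \<in> {- n..- n + int (length L)}" "real_of_int t / 10^12 < cf_lambda a (- j)"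
    by (auto simp: cf_lambda_reverse)
  then show ?thesis by (intro bexI[of _ "- j"]) auto
qed

text \<open>
  Conditionals instead of Boolean connectives make the evaluation by rewriting lazy.
\<close>

primrec search :: "nat \<Rightarrow> int \<Rightarrow> int \<Rightarrow> (int list \<times> int list) list \<Rightarrow>
    int list \<Rightarrow> int \<Rightarrow> int list \<Rightarrow> bool" where
  "search 0 t\<^sub>0 t\<^sub>1 G L c R = False"
| "search (Suc f) t\<^sub>0 t\<^sub>1 G L c R =
    (if lambda_below t\<^sub>0 L c R then True
     else if list_ex (\<lambda>(gl, gr). take (length gl) L = gl \<and> take (length gr) R = gr) G then True
     else if scan t\<^sub>1 L c R then True
     else if scan t\<^sub>1 R c L then True
     else if length R \<le> length L then
       (if search f t\<^sub>0 t\<^sub>1 G L c (R @ [1]) then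
        if search f t\<^sub>0 t\<^sub>1 G L c (R @ [2]) then search f t\<^sub>0 t\<^sub>1 G L c (R @ [3]) else False else False)
     else
       (if search f t\<^sub>0 t\<^sub>1 G (L @ [1]) c R then
        if search f t\<^sub>0 t\<^sub>1 G (L @ [2]) c R then search f t\<^sub>0 t\<^sub>1 G (L @ [3]) c R else False else False))"

text \<open>A branch closes when the centre is below \<open>t\<^sub>0\<close>, a goal is matched, or
  some value exceeds \<open>t\<^sub>1\<close>; otherwise the shorter side grows by each of the
  digits 1, 2, 3. Each step spends one unit of fuel on one digit, so the conditions on
  \<open>K\<close> keep the window where \<open>bnd\<close> holds.\<close>

lemma search_sound:
  assumes pos: "\<forall>i. a i > 0" and "window a n L c R" "search f t\<^sub>0 t\<^sub>1 G L c R"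
    and bnd: "\<forall>i \<in> {n - K..n + K}. cf_lambda a i < real_of_int t\<^sub>1 / 10^12" and t1: "t\<^sub>1 \<le> 4 * 10^12"
    and "int (length L + f) < K" "int (length R + f) < K"
    and low: "cf_lambda a n \<ge> real_of_int t\<^sub>0 / 10^12"
  shows "\<exists>(gl, gr) \<in> set G. digits_left a n gl \<and> digits_right a n gr"
proof -
  have dig: "a i \<in> {1, 2, 3}" if "i \<in> {n - K..n + K}" for i
  proof -
    \<comment> \<open>Every value exceeds its centre digit, so values below 4 leave only the digits
      1, 2, 3.\<close>
    have "real_of_int t\<^sub>1 \<le> real_of_int (4 * 10^12)" using t1 by (simp only: of_int_le_iff)
    then have "real_of_int t\<^sub>1 / 10^12 \<le> 4" by simp
    then have "real (a i) < 4" using cf_lambda_gt_digit[OF pos, of i] bnd that by fastforce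
    moreover have "a i > 0" using pos by blast
    ultimately show ?thesis by auto
  qed
  show ?thesis
    using assms(2,3,6,7)
  proof (induction f arbitrary: L R)
    case (Suc f)
    note w = Suc.prems(1)
    have l: "int (length L) + 1 < K" "int (length R) + 1 < K" using Suc.prems by auto
    have "\<not> lambda_below t\<^sub>0 L c R" using lambda_below_sound[OF pos w] low by force
    moreover have "\<not> scan t\<^sub>1 L c R"
    proof
      assume "scan t\<^sub>1 L c R"
      from scan_sound[OF pos w this] obtain j
        where "j \<in> {n..n + int (length R)}" "real_of_int t\<^sub>1 / 10^12 < cf_lambda a j" by blast
      with bnd[rule_format, of j] l show False by auto
    qed
    moreover have "\<not> scan t\<^sub>1 R c L"
    proof
      assume "scan t\<^sub>1 R c L"
      from scan_sound_left[OF pos w this] obtain j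
        where "j \<in> {n - int (length L)..n}" "real_of_int t\<^sub>1 / 10^12 < cf_lambda a j" by blast
      with bnd[rule_format, of j] l show False by auto
    qed
    ultimately consider
        (goal) gl gr where "(gl, gr) \<in> set G" "take (length gl) L = gl" "take (length gr) R = gr"
      | (right) "\<forall>d \<in> {1, 2, 3}. search f t\<^sub>0 t\<^sub>1 G L c (R @ [d])"
      | (left) "\<forall>d \<in> {1, 2, 3}. search f t\<^sub>0 t\<^sub>1 G (L @ [d]) c R"
      using Suc.prems(2) by (simp add: list_ex_iff split: if_splits) blast+
    then show ?case
    proof cases
      case goal
      have "digits_left a n L" "digits_right a n R" using w by (auto simp: window_def)
      then have "digits_left a n (take (length gl) L)" "digits_right a n (take (length gr) R)"
        by (auto intro: digits_left_take digits_right_take)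
      then show ?thesis using goal by (intro bexI[of _ "(gl, gr)"]) simp_all
    next
      case right
      define d where "d = int (a (n + 1 + int (length R)))"
      have "d \<in> {1, 2, 3}" using dig[of "n + 1 + int (length R)"] l by (auto simp: d_def)
      moreover have "a (n + 1 + int (length (R @ [d]))) \<le> 3"
        using dig[of "n + 1 + int (length (R @ [d]))"] l by auto
      then have "window a n L c (R @ [d])"
        using w by (simp add: window_def digits_right_append d_def)
      ultimately show ?thesis using right Suc.prems(3,4) by (intro Suc.IH[of L "R @ [d]"]) auto
    next
      case left
      define d where "d = int (a (n - 1 - int (length L)))"
      have "d \<in> {1, 2, 3}" using dig[of "n - 1 - int (length L)"] l by (auto simp: d_def)
      moreover have "a (n - 1 - int (length (L @ [d]))) \<le> 3"
        using dig[of "n - 1 - int (length (L @ [d]))"] l by auto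
      then have "window a n (L @ [d]) c R"
        using w by (simp add: window_def digits_left_append d_def)
      ultimately show ?thesis using left Suc.prems(3,4) by (intro Suc.IH[of "L @ [d]" R]) auto
    qed
  qed simp
qed

section \<open>Hausdorff dimension from the transfer operator\<close>

text \<open>At mesh 1 all diameters are at most 1, so for \<open>t < s\<close> the
  \<open>t\<close>-sums dominate the \<open>s\<close>-sums and stay at least
  \<open>\<kappa>\<close>. Hence no \<open>t < s\<close> has vanishing measure.\<close>

lemma hausdorff_dimension_ge:
  fixes A :: "'a::metric_space set"
  assumes "s > 0" "\<kappa> > 0"
    and cover: "\<And>U :: nat \<Rightarrow> 'a set. A \<subseteq> (\<Union>i. U i) \<Longrightarrow> (\<And>i. bounded (U i)) \<Longrightarrow> \<kappa> \<le> (\<Sum>i. diam_power s (U i))"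
  shows "hausdorff_dimension A \<ge> ereal s"
  unfolding hausdorff_dimension_def
proof (rule INF_greatest)
  fix t assume "t \<in> {s. 0 \<le> s \<and> hausdorff_outer_measure s A = 0}"
  then have t: "t \<ge> 0" "hausdorff_outer_measure t A = 0" by auto
  have "hausdorff_premeasure t 1 A \<le> hausdorff_outer_measure t A"
    unfolding hausdorff_outer_measure_def by (rule SUP_upper) simp
  then have "hausdorff_premeasure t 1 A < \<kappa>" using t \<open>\<kappa> > 0\<close> by simp
  then obtain U :: "nat \<Rightarrow> 'a set" where U: "A \<subseteq> (\<Union>i. U i)" "\<And>i. bounded (U i)"
      "\<And>i. diameter (U i) \<le> 1" and less: "(\<Sum>i. diam_power t (U i)) < \<kappa>"
    unfolding hausdorff_premeasure_def INF_less_iff by auto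
  show "ereal s \<le> ereal t"
  proof (rule ccontr)
    assume "\<not> ereal s \<le> ereal t"
    then have ts: "t < s" by simp
    have "diam_power s (U i) \<le> diam_power t (U i)" for i
    proof -
      have d: "diameter (U i) \<ge> 0" "diameter (U i) \<le> 1" using U diameter_ge_0 by auto
      have "diameter (U i) powr s \<le> diameter (U i) powr t" using d ts by (intro powr_mono') auto
      moreover have "diameter (U i) powr s \<le> 1" using d \<open>s > 0\<close> by (intro powr_le1) auto
      ultimately show ?thesis
        using \<open>s > 0\<close> by (auto simp: diam_power_def ennreal_leI simp flip: ennreal_1)
    qed
    then have "(\<Sum>i. diam_power s (U i)) \<le> (\<Sum>i. diam_power t (U i))" by (intro suminf_le) auto
    with cover[OF U(1,2)] less show False by simp
  qed
qed

section \<open>Inverse branches of the Gauss map and their distortion\<close>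

primrec cf_mobius :: "nat list \<Rightarrow> real \<Rightarrow> real" where
  "cf_mobius [] x = x"
| "cf_mobius (d # w) x = 1 / (real d + cf_mobius w x)"

text \<open>\<open>cf_denom w x\<close> is \<open>\<bar>(cf_mobius w)' x\<bar> powr (- 1/2)\<close>.\<close>

primrec cf_denom :: "nat list \<Rightarrow> real \<Rightarrow> real" where
  "cf_denom [] x = 1"
| "cf_denom (d # w) x = (real d + cf_mobius w x) * cf_denom w x"

lemma cf_mobius_append: "cf_mobius (u @ v) x = cf_mobius u (cf_mobius v x)"
  by (induction u) auto

lemma cf_denom_append: "cf_denom (u @ v) x = cf_denom u (cf_mobius v x) * cf_denom v x"
  by (induction u) (auto simp: cf_mobius_append)

text \<open>
  An interval invariant under \<open>x \<mapsto> 1 / (1 + x)\<close> and \<open>x \<mapsto> 1 / (2 + x)\<close>.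
\<close>

definition cf_interval :: "real set" where
  "cf_interval = {4/11..3/4}"

lemma cf_mobius_mem:
  assumes "set w \<subseteq> {1, 2}" "x \<in> cf_interval"
  shows "cf_mobius w x \<in> cf_interval"
  using assms(1)
proof (induction w)
  case (Cons d w)
  then have y: "cf_mobius w x \<in> cf_interval" and d: "real d \<ge> 1" "real d \<le> 2" by auto
  show ?case using y d by (auto simp: cf_interval_def field_simps)
qed (simp add: assms)

text \<open>Each factor is at least \<open>1 + 4/11\<close>: the smallest digit plus the left end of
  \<open>cf_interval\<close>.\<close>

lemma cf_denom_ge:
  assumes "set w \<subseteq> {1, 2}" "x \<in> cf_interval"
  shows "(15/11) ^ length w \<le> cf_denom w x"
  using assms(1)
proof (induction w)
  case (Cons d w)
  then have "cf_mobius w x \<in> cf_interval" "real d \<ge> 1" using cf_mobius_mem[OF _ assms(2)] by auto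
  then have "15/11 \<le> real d + cf_mobius w x" by (auto simp: cf_interval_def)
  moreover have "(15/11) ^ length w \<le> cf_denom w x" using Cons by simp
  ultimately have "15/11 * (15/11) ^ length w \<le> (real d + cf_mobius w x) * cf_denom w x"
    by (intro mult_mono) auto
  then show ?case by simp
qed simp

lemma cf_denom_pos: "set w \<subseteq> {1, 2} \<Longrightarrow> x \<in> cf_interval \<Longrightarrow> cf_denom w x > 0"
  by (rule less_le_trans[OF _ cf_denom_ge]) auto

lemma cf_mobius_pos: "x > 0 \<Longrightarrow> cf_mobius w x > 0"
  by (induction w) (auto intro!: add_nonneg_pos)

text \<open>For a Moebius map of determinant 1 or -1 the difference quotient is, in absolute value,
  exactly the geometric mean of the derivatives at the two points.\<close>

lemma cf_mobius_diff:
  assumes "x > 0" "y > 0"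
  shows "\<bar>cf_mobius w x - cf_mobius w y\<bar> = \<bar>x - y\<bar> / (cf_denom w x * cf_denom w y)"
proof (induction w)
  case (Cons d w)
  define X Y where "X = real d + cf_mobius w x" and "Y = real d + cf_mobius w y"
  have pos: "X > 0" "Y > 0"
    using cf_mobius_pos assms by (auto simp: X_def Y_def intro!: add_nonneg_pos)
  have "\<bar>1/X - 1/Y\<bar> = \<bar>X - Y\<bar> / (X * Y)"
  proof -
    have "1/X - 1/Y = (Y - X) / (X * Y)" using pos by (simp add: field_simps)
    then show ?thesis using pos by (simp add: abs_minus_commute)
  qed
  also have "\<bar>X - Y\<bar> = \<bar>x - y\<bar> / (cf_denom w x * cf_denom w y)"
    using Cons by (simp add: X_def Y_def)
  finally show ?case by (simp add: X_def Y_def mult_ac)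
qed simp

text \<open>\<open>C + D * x\<close> and \<open>A + B * x\<close> are numerator and denominator of
  the Moebius map of \<open>w\<close>. Prepending \<open>d\<close> turns the pair
  \<open>(P, Q)\<close> into \<open>(Q, d * Q + P)\<close>, which keeps coefficients
  nonnegative.\<close>

lemma cf_denom_affine:
  assumes "set w \<subseteq> {1, 2}"
  shows "\<exists>A B C D. A \<ge> 0 \<and> B \<ge> 0 \<and> C \<ge> 0 \<and> D \<ge> 0 \<and>
    (\<forall>x \<in> cf_interval. cf_denom w x = A + B * x \<and> cf_mobius w x * cf_denom w x = C + D * x)"
  using assms
proof (induction w)
  case Nil
  show ?case by (rule exI[of _ 1], rule exI[of _ 0], rule exI[of _ 0], rule exI[of _ 1]) simp
next
  case (Cons d w)
  then have "set w \<subseteq> {1, 2}" by simp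
  from Cons.IH[OF this] obtain A B C D where nn: "A \<ge> 0" "B \<ge> 0" "C \<ge> 0" "D \<ge> 0"
    and eq: "\<And>x. x \<in> cf_interval \<Longrightarrow> cf_denom w x = A + B * x \<and> cf_mobius w x * cf_denom w x = C + D * x"
    by blast
  have pos: "real d + cf_mobius w x > 0" if "x \<in> cf_interval" for x
    using cf_mobius_mem[of w x] Cons.prems that by (auto simp: cf_interval_def)
  have "cf_denom (d # w) x = (real d * A + C) + (real d * B + D) * x \<and>
      cf_mobius (d # w) x * cf_denom (d # w) x = A + B * x" if "x \<in> cf_interval" for x
  proof -
    have "cf_mobius (d # w) x * cf_denom (d # w) x = cf_denom w x" using pos[OF that] by simp
    moreover have "cf_denom (d # w) x = real d * cf_denom w x + cf_mobius w x * cf_denom w x"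
      by (simp add: distrib_right)
    then have "cf_denom (d # w) x = real d * (A + B * x) + (C + D * x)" using eq[OF that] by metis
    ultimately show ?thesis using eq[OF that] by (simp only: distrib_left distrib_right) (simp add: mult_ac)
  qed
  then have "\<forall>x \<in> cf_interval. cf_denom (d # w) x = (real d * A + C) + (real d * B + D) * x \<and>
      cf_mobius (d # w) x * cf_denom (d # w) x = A + B * x" by blast
  moreover have "real d * A + C \<ge> 0" "real d * B + D \<ge> 0" using nn by auto
  ultimately show ?case using nn by blast
qed

text \<open>An affine function with nonnegative coefficients grows at most in proportion to its
  argument, and the endpoints of \<open>cf_interval\<close> have ratio
  \<open>33/16 < 3\<close>.\<close>

lemma cf_denom_distortion:
  assumes "set w \<subseteq> {1, 2}" "x \<in> cf_interval" "y \<in> cf_interval"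
  shows "cf_denom w x \<le> 3 * cf_denom w y"
proof -
  obtain A B where "A \<ge> 0" "B \<ge> 0" "\<And>x. x \<in> cf_interval \<Longrightarrow> cf_denom w x = A + B * x"
    using cf_denom_affine[OF assms(1)] by blast
  moreover have "x \<le> 3 * y" using assms by (auto simp: cf_interval_def)
  ultimately show ?thesis
    using assms mult_left_mono[of x "3 * y" B] by (simp add: algebra_simps)
qed

lemma sum_UN_le:
  fixes g :: "'a \<Rightarrow> real"
  assumes "finite I" "\<And>i. i \<in> I \<Longrightarrow> finite (B i)" "\<And>i x. i \<in> I \<Longrightarrow> x \<in> B i \<Longrightarrow> g x \<ge> 0"
  shows "sum g (\<Union>i \<in> I. B i) \<le> (\<Sum>i \<in> I. sum g (B i))"
  using assms
proof (induction I rule: finite_induct)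
  case (insert i I)
  have "sum g (B i \<union> (\<Union>i \<in> I. B i)) + sum g (B i \<inter> (\<Union>i \<in> I. B i)) = sum g (B i) + sum g (\<Union>i \<in> I. B i)"
    using insert by (intro sum.union_inter) auto
  moreover have "sum g (B i \<inter> (\<Union>i \<in> I. B i)) \<ge> 0" using insert.prems by (intro sum_nonneg) auto
  moreover have "sum g (\<Union>i \<in> I. B i) \<le> (\<Sum>i \<in> I. sum g (B i))"
    using insert.prems by (intro insert.IH) auto
  ultimately show ?case using insert.hyps by simp
qed simp

section \<open>Finite words and compactness of the space of binary sequences\<close>

definition words :: "nat \<Rightarrow> nat list set" where
  "words n = {w. set w \<subseteq> {1, 2} \<and> length w = n}"

lemma finite_words: "finite (words n)"
  unfolding words_def by (rule finite_lists_length_eq) simp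

lemma words_0: "words 0 = {[]}"
  by (auto simp: words_def)

lemma sum_words_Suc: "sum g (words (Suc n)) = (\<Sum>w \<in> words n. g (1 # w) + g (2 # w))"
proof -
  have "words (Suc n) = (#) 1 ` words n \<union> (#) 2 ` words n"
    by (auto simp: words_def length_Suc_conv image_iff)
  then have "sum g (words (Suc n)) = sum g ((#) 1 ` words n) + sum g ((#) 2 ` words n)"
    by (simp only:) (rule sum.union_disjoint, auto simp: finite_words)
  then show ?thesis by (simp add: sum.reindex sum.distrib)
qed

definition binary_seqs :: "(nat \<Rightarrow> nat) set" where
  "binary_seqs = {b. \<forall>k. b k \<in> {1, 2}}"

definition initial :: "(nat \<Rightarrow> nat) \<Rightarrow> nat \<Rightarrow> nat list" where
  "initial b n = map b [0..<n]"

lemma length_initial [simp]: "length (initial b n) = n"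
  by (simp add: initial_def)

lemma initial_Suc: "initial b (Suc n) = initial b n @ [b n]"
  by (simp add: initial_def)

lemma set_initial: "b \<in> binary_seqs \<Longrightarrow> set (initial b n) \<subseteq> {1, 2}"
  by (auto simp: initial_def binary_seqs_def)

lemma take_initial: "k \<le> n \<Longrightarrow> take k (initial b n) = initial b k"
  by (simp add: initial_def take_map take_upt)

lemma initial_cong: "(\<And>k. k < n \<Longrightarrow> b k = b' k) \<Longrightarrow> initial b n = initial b' n"
  by (simp add: initial_def)

lemma initial_extension:
  assumes "set w \<subseteq> {1, 2}"
  obtains b where "b \<in> binary_seqs" "initial b (length w) = w"
proof
  let ?b = "\<lambda>k. if k < length w then w ! k else 1"
  have "w ! k \<in> {1, 2}" if "k < length w" for k using assms nth_mem[OF that] by blast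
  then show "?b \<in> binary_seqs" by (auto simp: binary_seqs_def)
  show "initial ?b (length w) = w" by (rule nth_equalityI) (simp_all add: initial_def)
qed

text \<open>Koenig's lemma: a word all of whose extensions are finitely covered is itself finitely covered.\<close>

lemma finite_subcover:
  assumes "\<And>b. b \<in> binary_seqs \<Longrightarrow> \<exists>u \<in> V. initial b (length u) = u"
  shows "\<exists>W \<subseteq> V. finite W \<and> (\<forall>b \<in> binary_seqs. \<exists>u \<in> W. initial b (length u) = u)"
proof (rule ccontr)
  define good where "good w \<longleftrightarrow> (\<exists>W \<subseteq> V. finite W \<and>
    (\<forall>b \<in> binary_seqs. initial b (length w) = w \<longrightarrow> (\<exists>u \<in> W. initial b (length u) = u)))" for w
  assume "\<not> ?thesis"
  then have "\<not> good []" by (simp add: good_def initial_def)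
  have step: "\<exists>d \<in> {1, 2}. \<not> good (w @ [d])" if "\<not> good w" for w
  proof (rule ccontr)
    assume "\<not> ?thesis"
    then obtain W1 W2 where W: "W1 \<subseteq> V" "finite W1" "W2 \<subseteq> V" "finite W2"
      and c1: "\<And>b. b \<in> binary_seqs \<Longrightarrow> initial b (Suc (length w)) = w @ [1] \<Longrightarrow> \<exists>u \<in> W1. initial b (length u) = u"
      and c2: "\<And>b. b \<in> binary_seqs \<Longrightarrow> initial b (Suc (length w)) = w @ [2] \<Longrightarrow> \<exists>u \<in> W2. initial b (length u) = u"
      by (auto simp: good_def)
    have "\<exists>u \<in> W1 \<union> W2. initial b (length u) = u" if b: "b \<in> binary_seqs" "initial b (length w) = w" for b
    proof -
      have "b (length w) = 1 \<or> b (length w) = 2" using b by (auto simp: binary_seqs_def)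
      then have "initial b (Suc (length w)) = w @ [1] \<or> initial b (Suc (length w)) = w @ [2]"
        using b by (auto simp: initial_Suc)
      then show ?thesis using c1[OF b(1)] c2[OF b(1)] by blast
    qed
    then have "good w" unfolding good_def using W by (intro exI[of _ "W1 \<union> W2"]) auto
    with that show False by blast
  qed
  define next_digit where "next_digit w = (SOME d. d \<in> {1::nat, 2} \<and> \<not> good (w @ [d]))" for w
  define path where "path = rec_nat [] (\<lambda>_ w. w @ [next_digit w])"
  have path: "path 0 = []" "path (Suc n) = path n @ [next_digit (path n)]" for n
    by (simp_all add: path_def)
  have nd: "next_digit w \<in> {1, 2} \<and> \<not> good (w @ [next_digit w])" if "\<not> good w" for w
    unfolding next_digit_def using someI_ex[of "\<lambda>d. d \<in> {1, 2} \<and> \<not> good (w @ [d])"] step[OF that] by blast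
  have bad: "\<not> good (path n)" for n
    by (induction n) (use \<open>\<not> good []\<close> nd in \<open>auto simp: path\<close>)
  define b where "b n = next_digit (path n)" for n
  have init: "initial b n = path n" for n
    by (induction n) (auto simp: path initial_Suc b_def initial_def[of _ 0])
  have "b \<in> binary_seqs" using nd[OF bad] by (auto simp: binary_seqs_def b_def)
  from assms[OF this] obtain u where u: "u \<in> V" "initial b (length u) = u" by blast
  then have "path (length u) = u" by (simp add: init)
  then have "good (path (length u))"
    unfolding good_def using u(1) by (intro exI[of _ "{u}"]) auto
  with bad show False by blast
qed

text \<open>
  The right-hand side of \<open>f_sub\<close> is the transfer operator of the two inverse branches.
\<close>

locale subinvariant =
  fixes s :: real and f :: "real \<Rightarrow> real"
  assumes s_pos: "s > 0"
    and f_pos: "x \<in> cf_interval \<Longrightarrow> f x > 0"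
    and f_harnack: "x \<in> cf_interval \<Longrightarrow> y \<in> cf_interval \<Longrightarrow> f x \<le> 2 * f y"
    and f_sub: "x \<in> cf_interval \<Longrightarrow>
      f x \<le> (1 + x) powr (- 2 * s) * f (1 / (1 + x)) + (2 + x) powr (- 2 * s) * f (1 / (2 + x))"
begin

section \<open>Distribution of mass over cylinders\<close>

definition base :: real where "base = 1/2"

lemma base_mem: "base \<in> cf_interval"
  by (simp add: base_def cf_interval_def)

text \<open>Up to bounded factors, the length of the cylinder of \<open>w\<close> to the power
  \<open>s\<close>.\<close>

definition scale :: "nat list \<Rightarrow> real" where
  "scale w = cf_denom w base powr (- 2 * s)"

definition weight :: "nat list \<Rightarrow> real" where
  "weight w = scale w * f (cf_mobius w base)"

text \<open>The \<open>n\<close>-th iterate of the transfer operator applied to \<open>f\<close>,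
  evaluated at \<open>base\<close>; \<open>weight w\<close> is the summand of the branch
  \<open>w\<close>.\<close>

definition mass :: "nat \<Rightarrow> real" where
  "mass n = sum weight (words n)"

text \<open>The power of 3 pays for moving the base point in \<open>cf_denom_distortion\<close>; the
  2 is the constant of \<open>f_harnack\<close>.\<close>

definition distortion :: real where
  "distortion = 2 * 3 powr (2 * s)"

lemma distortion_pos: "distortion > 0"
  by (simp add: distortion_def)

lemma scale_pos: "set w \<subseteq> {1, 2} \<Longrightarrow> scale w > 0"
  using cf_denom_pos[OF _ base_mem, of w] by (simp add: scale_def)

lemma weight_pos: "set w \<subseteq> {1, 2} \<Longrightarrow> weight w > 0"
  unfolding weight_def by (intro mult_pos_pos scale_pos f_pos cf_mobius_mem base_mem)

text \<open>This is \<open>f_sub\<close> at the image point of \<open>w\<close>, multiplied by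
  \<open>scale w\<close>. Digits are prepended because the new branch is applied last.\<close>

lemma weight_le_children:
  assumes "set w \<subseteq> {1, 2}"
  shows "weight w \<le> weight (1 # w) + weight (2 # w)"
proof -
  define y where "y = cf_mobius w base"
  have y: "y \<in> cf_interval" using cf_mobius_mem[OF assms base_mem] by (simp add: y_def)
  then have "y > 0" by (auto simp: cf_interval_def)
  have "cf_denom w base > 0" using cf_denom_pos[OF assms base_mem] .
  then have "weight (1 # w) + weight (2 # w) = scale w *
      ((1 + y) powr (- 2 * s) * f (1 / (1 + y)) + (2 + y) powr (- 2 * s) * f (1 / (2 + y)))"
    using \<open>y > 0\<close> unfolding weight_def scale_def cf_denom.simps cf_mobius.simps y_def[symmetric]
    by (simp only: powr_mult of_nat_1 of_nat_numeral) (simp only: distrib_left mult_ac)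
  also have "\<dots> \<ge> scale w * f y"
    using f_sub[OF y] scale_pos[OF assms] by (intro mult_left_mono) auto
  finally show ?thesis by (simp add: weight_def y_def)
qed

lemma mass_mono: "m \<le> n \<Longrightarrow> mass m \<le> mass n"
proof (rule lift_Suc_mono_le[of mass])
  show "mass n \<le> mass (Suc n)" for n
    unfolding mass_def sum_words_Suc
    by (intro sum_mono weight_le_children) (simp add: words_def)
qed

lemma mass_pos: "mass n > 0"
proof -
  have "mass 0 > 0" using weight_pos[of "[]"] by (simp add: mass_def words_0)
  then show ?thesis using mass_mono[of 0 n] by simp
qed

text \<open>The chain rule evaluates the denominator of \<open>u\<close> at \<open>y\<close> instead
  of \<open>base\<close>, which costs the distortion; \<open>f_harnack\<close> replaces
  \<open>f\<close> at the image of \<open>y\<close> by \<open>f y\<close>.\<close>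

lemma weight_append_le:
  assumes "set u \<subseteq> {1, 2}" "set v \<subseteq> {1, 2}"
  shows "weight (u @ v) \<le> distortion * scale u * weight v"
proof -
  define y where "y = cf_mobius v base"
  have y: "y \<in> cf_interval" using cf_mobius_mem[OF assms(2) base_mem] by (simp add: y_def)
  have pos: "cf_denom v base > 0" "cf_denom u y > 0" "cf_denom u base > 0"
    using cf_denom_pos assms y base_mem by auto
  have "cf_denom u base / 3 \<le> cf_denom u y"
    using cf_denom_distortion[OF assms(1) base_mem y] by simp
  then have "cf_denom u y powr (- 2 * s) \<le> (cf_denom u base / 3) powr (- 2 * s)"
    using pos s_pos by (intro powr_mono2') auto
  also have "\<dots> = 3 powr (2 * s) * scale u"
    using pos by (simp add: powr_divide scale_def powr_minus field_simps)
  finally have 1: "cf_denom u y powr (- 2 * s) \<le> 3 powr (2 * s) * scale u" .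
  have 2: "f (cf_mobius u y) \<le> 2 * f y" using f_harnack cf_mobius_mem assms(1) y by blast
  have "weight (u @ v) = cf_denom u y powr (- 2 * s) * scale v * f (cf_mobius u y)"
    using pos by (simp add: weight_def scale_def cf_denom_append cf_mobius_append powr_mult flip: y_def)
  also have "\<dots> \<le> (3 powr (2 * s) * scale u) * scale v * (2 * f y)"
    using 1 2 scale_pos assms f_pos[of "cf_mobius u y"] cf_mobius_mem[OF assms(1) y]
    by (intro mult_mono) (auto intro!: mult_nonneg_nonneg simp: less_imp_le)
  finally show ?thesis by (simp add: distortion_def weight_def y_def mult_ac)
qed

text \<open>For large \<open>n\<close> every word of length \<open>n\<close> has a prefix in
  \<open>W\<close>, so \<open>weight_append_le\<close> and monotonicity bound \<open>mass n\<close>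
  by \<open>distortion * (\<Sum>u \<in> W. scale u) * mass n\<close>; then \<open>mass n\<close>
  cancels.\<close>

lemma finite_cover_scale:
  assumes "finite W" "\<And>u. u \<in> W \<Longrightarrow> set u \<subseteq> {1, 2}"
    and "\<And>b. b \<in> binary_seqs \<Longrightarrow> \<exists>u \<in> W. initial b (length u) = u"
  shows "1 \<le> distortion * (\<Sum>u \<in> W. scale u)"
proof -
  obtain n where n: "\<And>u. u \<in> W \<Longrightarrow> length u \<le> n"
    using finite_imageI[OF assms(1), of length] by (meson finite_nat_set_iff_bounded_le imageI)
  have sub: "words n \<subseteq> (\<Union>u \<in> W. (\<lambda>v. u @ v) ` words (n - length u))"
  proof
    fix w assume "w \<in> words n"
    then have w: "set w \<subseteq> {1, 2}" "length w = n" by (auto simp: words_def)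
    obtain b where b: "b \<in> binary_seqs" "initial b n = w" using initial_extension[OF w(1)] w(2) by blast
    obtain u where u: "u \<in> W" "initial b (length u) = u" using assms(3) b by blast
    have "take (length u) w = u" using take_initial[OF n[OF u(1)], of b] b u by simp
    then have "w = u @ drop (length u) w" by (metis append_take_drop_id)
    moreover have "drop (length u) w \<in> words (n - length u)"
      using w set_drop_subset[of "length u" w] by (auto simp: words_def)
    ultimately show "w \<in> (\<Union>u \<in> W. (\<lambda>v. u @ v) ` words (n - length u))" using u by blast
  qed
  have "mass n \<le> (\<Sum>w \<in> (\<Union>u \<in> W. (\<lambda>v. u @ v) ` words (n - length u)). weight w)"
    unfolding mass_def using assms(1,2) sub
    by (intro sum_mono2 finite_UN_I finite_imageI finite_words)
      (auto simp: less_imp_le[OF weight_pos] words_def)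
  also have "\<dots> \<le> (\<Sum>u \<in> W. \<Sum>w \<in> (\<lambda>v. u @ v) ` words (n - length u). weight w)"
    using assms(1,2)
    by (intro sum_UN_le finite_imageI finite_words) (auto simp: less_imp_le[OF weight_pos] words_def)
  also have "\<dots> \<le> (\<Sum>u \<in> W. distortion * scale u * mass n)"
  proof (rule sum_mono)
    fix u assume u: "u \<in> W"
    have "(\<Sum>w \<in> (\<lambda>v. u @ v) ` words (n - length u). weight w) =
        (\<Sum>v \<in> words (n - length u). weight (u @ v))"
      by (subst sum.reindex) (auto simp: inj_on_def)
    also have "\<dots> \<le> (\<Sum>v \<in> words (n - length u). distortion * scale u * weight v)"
      using assms(2)[OF u] by (intro sum_mono weight_append_le) (auto simp: words_def)
    also have "\<dots> = distortion * scale u * mass (n - length u)"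
      by (simp add: mass_def sum_distrib_left)
    also have "\<dots> \<le> distortion * scale u * mass n"
      using distortion_pos scale_pos[OF assms(2)[OF u]]
      by (intro mult_left_mono mass_mono mult_nonneg_nonneg) auto
    finally show "(\<Sum>w \<in> (\<lambda>v. u @ v) ` words (n - length u). weight w) \<le> distortion * scale u * mass n" .
  qed
  also have "\<dots> = distortion * (\<Sum>u \<in> W. scale u) * mass n"
    by (simp add: sum_distrib_left sum_distrib_right mult_ac)
  finally show ?thesis using mass_pos[of n] by simp
qed

lemma scale_initial_small:
  assumes "b \<in> binary_seqs" "\<epsilon> > 0"
  shows "\<exists>n. scale (initial b n) \<le> \<epsilon>"
proof -
  define r where "r = (15/11::real) powr (- 2 * s)"
  have "0 \<le> r" "r < 1" using s_pos powr_less_one[of "15/11" "- 2 * s"] by (auto simp: r_def)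
  then obtain n where n: "r ^ n < \<epsilon>" using real_arch_pow_inv[OF assms(2)] by blast
  have "scale (initial b n) \<le> ((15/11) ^ n) powr (- 2 * s)"
    unfolding scale_def using cf_denom_ge[OF set_initial[OF assms(1)] base_mem, of n] s_pos
    by (intro powr_mono2') auto
  also have "\<dots> = r ^ n" by (simp add: r_def powr_powr powr_power mult_ac flip: powr_realpow)
  finally show ?thesis using n by (intro exI[of _ n]) simp
qed

text \<open>The word is the longest common prefix of the sequences in \<open>S\<close>: two of them
  separate right after it, so \<open>gap\<close> controls its scale by the diameter. If
  \<open>S\<close> is a single sequence, a long enough prefix, paid for by
  \<open>\<epsilon>\<close>, takes its place.\<close>

lemma covering_word:
  fixes F :: "(nat \<Rightarrow> nat) \<Rightarrow> real"
  assumes "c > 0" "\<epsilon> > 0"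
    and gap: "\<And>b b' n. b \<in> binary_seqs \<Longrightarrow> b' \<in> binary_seqs \<Longrightarrow> (\<And>k. k < n \<Longrightarrow> b k = b' k) \<Longrightarrow> b n \<noteq> b' n \<Longrightarrow>
      c / (cf_denom (initial b n) base)\<^sup>2 \<le> \<bar>F b - F b'\<bar>"
    and S: "S \<subseteq> binary_seqs" "S \<noteq> {}" "F ` S \<subseteq> U" "bounded U"
  shows "\<exists>u. set u \<subseteq> {1, 2} \<and> (\<forall>b \<in> S. initial b (length u) = u) \<and>
    scale u \<le> c powr (- s) * diameter U powr s + \<epsilon>"
proof (cases "\<exists>n. \<exists>b \<in> S. \<exists>b' \<in> S. b n \<noteq> b' n")
  case True
  define n where "n = (LEAST n. \<exists>b \<in> S. \<exists>b' \<in> S. b n \<noteq> b' n)"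
  have "\<exists>b \<in> S. \<exists>b' \<in> S. b n \<noteq> b' n" unfolding n_def using True by (rule LeastI_ex)
  then obtain b b' where b: "b \<in> S" "b' \<in> S" "b n \<noteq> b' n" by blast
  have agree: "d k = d' k" if "k < n" "d \<in> S" "d' \<in> S" for k d d'
    using not_less_Least[of k "\<lambda>n. \<exists>b \<in> S. \<exists>b' \<in> S. b n \<noteq> b' n"] that unfolding n_def by blast
  define u where "u = initial b n"
  have bb: "b \<in> binary_seqs" "b' \<in> binary_seqs" using b S by auto
  have pos: "cf_denom u base > 0" using cf_denom_pos[OF set_initial[OF bb(1)] base_mem] by (simp add: u_def)
  have "c / (cf_denom u base)\<^sup>2 \<le> \<bar>F b - F b'\<bar>"
    unfolding u_def using b agree bb by (intro gap) auto
  also have "\<dots> \<le> diameter U"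
    using diameter_bounded_bound[OF S(4), of "F b" "F b'"] S(3) b by (auto simp: dist_real_def)
  finally have "cf_denom u base powr (- 2) \<le> diameter U / c"
    using \<open>c > 0\<close> pos by (simp add: powr_minus field_simps)
  then have "(cf_denom u base powr (- 2)) powr s \<le> (diameter U / c) powr s"
    using s_pos by (intro powr_mono2) auto
  also have "(diameter U / c) powr s = c powr (- s) * diameter U powr s"
    using \<open>c > 0\<close> diameter_ge_0[OF S(4)] by (simp add: powr_divide powr_minus field_simps)
  also have "(cf_denom u base powr (- 2)) powr s = scale u"
    by (simp add: scale_def powr_powr)
  finally have "scale u \<le> c powr (- s) * diameter U powr s + \<epsilon>" using \<open>\<epsilon> > 0\<close> by simp
  moreover have "\<forall>d \<in> S. initial d (length u) = u"
    using agree b(1) by (auto simp: u_def intro: initial_cong)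
  ultimately show ?thesis using set_initial[OF bb(1)] by (intro exI[of _ u]) (auto simp: u_def)
next
  case False
  obtain b where b: "b \<in> S" using S by blast
  have eq: "b' = b" if "b' \<in> S" for b' using False b that by blast
  obtain n where n: "scale (initial b n) \<le> \<epsilon>" using scale_initial_small[of b \<epsilon>] b S \<open>\<epsilon> > 0\<close> by blast
  have "scale (initial b n) \<le> c powr (- s) * diameter U powr s + \<epsilon>"
    using n by (auto intro!: add_increasing)
  moreover have "set (initial b n) \<subseteq> {1, 2}" using set_initial b S by blast
  moreover have "\<forall>b' \<in> S. initial b' (length (initial b n)) = initial b n" using eq by simp
  ultimately show ?thesis by blast
qed

theorem hausdorff_dimension_image_ge:
  fixes F :: "(nat \<Rightarrow> nat) \<Rightarrow> real"
  assumes "c > 0"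
    and gap: "\<And>b b' n. b \<in> binary_seqs \<Longrightarrow> b' \<in> binary_seqs \<Longrightarrow> (\<And>k. k < n \<Longrightarrow> b k = b' k) \<Longrightarrow> b n \<noteq> b' n \<Longrightarrow>
      c / (cf_denom (initial b n) base)\<^sup>2 \<le> \<bar>F b - F b'\<bar>"
    and sub: "F ` binary_seqs \<subseteq> A"
  shows "hausdorff_dimension A \<ge> ereal s"
proof (rule hausdorff_dimension_ge[OF s_pos])
  define \<kappa> where "\<kappa> = c powr s / (2 * distortion)"
  have "\<kappa> > 0" using \<open>c > 0\<close> distortion_pos by (simp add: \<kappa>_def)
  then show "ennreal \<kappa> > 0" by simp
  fix U :: "nat \<Rightarrow> real set"
  assume U: "A \<subseteq> (\<Union>i. U i)" "\<And>i. bounded (U i)"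
  define S where "S i = {b \<in> binary_seqs. F b \<in> U i}" for i
  define J where "J = {i. S i \<noteq> {}}"
  \<comment> \<open>These errors add up to at most \<open>1 / (2 * distortion)\<close>, half of what
    \<open>finite_cover_scale\<close> guarantees; the other half gives
    \<open>\<kappa>\<close>.\<close>
  define \<epsilon> where "\<epsilon> i = 1 / (2 * distortion) * (1/2) ^ Suc i" for i
  have "\<exists>u. set u \<subseteq> {1, 2} \<and> (\<forall>b \<in> S i. initial b (length u) = u) \<and>
      scale u \<le> c powr (- s) * diameter (U i) powr s + \<epsilon> i" if "i \<in> J" for i
    by (rule covering_word[OF \<open>c > 0\<close> _ gap])
       (use that U distortion_pos in \<open>auto simp: S_def J_def \<epsilon>_def\<close>)
  then obtain u where u: "\<And>i. i \<in> J \<Longrightarrow> set (u i) \<subseteq> {1, 2} \<and> (\<forall>b \<in> S i. initial b (length (u i)) = u i) \<and>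
      scale (u i) \<le> c powr (- s) * diameter (U i) powr s + \<epsilon> i"
    by metis
  have "\<exists>v \<in> u ` J. initial b (length v) = v" if b: "b \<in> binary_seqs" for b
  proof -
    obtain i where "F b \<in> U i" using b sub U(1) by blast
    then have "b \<in> S i" "i \<in> J" using b by (auto simp: S_def J_def)
    then show ?thesis using u by blast
  qed
  from finite_subcover[OF this] obtain W where W: "W \<subseteq> u ` J" "finite W"
      "\<And>b. b \<in> binary_seqs \<Longrightarrow> \<exists>v \<in> W. initial b (length v) = v" by blast
  obtain K where K: "K \<subseteq> J" "finite K" "W = u ` K"
    using finite_subset_image[OF W(2,1)] by blast
  have "(\<Sum>v \<in> W. scale v) \<le> (\<Sum>i \<in> K. scale (u i))"
    unfolding K(3) using sum_image_le[of K scale u] K(1,2) u scale_pos by (fastforce intro: less_imp_le simp: o_def)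
  also have "\<dots> \<le> (\<Sum>i \<in> K. c powr (- s) * diameter (U i) powr s + \<epsilon> i)"
    using u K(1) by (intro sum_mono) auto
  also have "\<dots> = c powr (- s) * (\<Sum>i \<in> K. diameter (U i) powr s) + (\<Sum>i \<in> K. \<epsilon> i)"
    by (simp add: sum.distrib sum_distrib_left)
  also have "(\<Sum>i \<in> K. \<epsilon> i) \<le> 1 / (2 * distortion)"
  proof -
    have "(\<lambda>i. (1/2::real) ^ Suc i) sums 1" by (rule power_half_series)
    then have "(\<Sum>i \<in> K. (1/2::real) ^ Suc i) \<le> 1"
      using sum_le_suminf[of "\<lambda>i. (1/2::real) ^ Suc i" K] K(2) by (auto simp: sums_iff)
    then show ?thesis
      using distortion_pos unfolding \<epsilon>_def sum_distrib_left[symmetric] by (intro mult_left_le) auto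
  qed
  finally have "(\<Sum>v \<in> W. scale v) \<le> c powr (- s) * (\<Sum>i \<in> K. diameter (U i) powr s) + 1 / (2 * distortion)"
    by simp
  then have "distortion * (\<Sum>v \<in> W. scale v) \<le>
      distortion * (c powr (- s) * (\<Sum>i \<in> K. diameter (U i) powr s) + 1 / (2 * distortion))"
    using distortion_pos by (intro mult_left_mono) auto
  moreover have "1 \<le> distortion * (\<Sum>v \<in> W. scale v)"
    using W u by (intro finite_cover_scale) blast+
  ultimately have "1 \<le> distortion * (c powr (- s) * (\<Sum>i \<in> K. diameter (U i) powr s)) + 1/2"
    using distortion_pos by (simp add: distrib_left)
  then have "\<kappa> \<le> (\<Sum>i \<in> K. diameter (U i) powr s)"
    using distortion_pos \<open>c > 0\<close> by (simp add: \<kappa>_def powr_minus field_simps)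
  then have "ennreal \<kappa> \<le> (\<Sum>i \<in> K. ennreal (diameter (U i) powr s))"
    by (simp add: ennreal_leI)
  \<comment> \<open>Indices in \<open>J\<close> have nonempty \<open>U i\<close>, so
    \<open>diam_power\<close> takes its power clause.\<close>
  also have "\<dots> = (\<Sum>i \<in> K. diam_power s (U i))"
    using K(1) s_pos by (intro sum.cong) (auto simp: diam_power_def J_def S_def)
  also have "\<dots> \<le> (\<Sum>i. diam_power s (U i))" using K(2) by (intro sum_le_suminf) auto
  finally show "ennreal \<kappa> \<le> (\<Sum>i. diam_power s (U i))" .
qed

end

section \<open>A subinvariant polynomial for the digits 1 and 2\<close>

text \<open>The Lagrange remainder of even order is nonnegative.\<close>

lemma powr_neg_ge_taylor:
  fixes a u :: real
  assumes "a > 0" "u > -1"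
  shows "(\<Sum>k<6. ((- a) gchoose k) * u ^ k) \<le> (1 + u) powr (- a)"
proof (cases "u = 0")
  case True
  have "(\<Sum>k<6. ((- a) gchoose k) * u ^ k) = 1" by (simp add: True numeral_eq_Suc)
  then show ?thesis by (simp add: True)
next
  case False
  \<comment> \<open>\<open>D m\<close> is the \<open>m\<close>-th derivative of
    \<open>(1 + t) powr (- a)\<close> in \<open>t\<close>.\<close>
  define D where "D m t = fact m * ((- a) gchoose m) * (1 + t) powr (- a - real m)" for m t
  have "DERIV (D m) t :> D (Suc m) t" if "1 + t > 0" for m t
  proof -
    have coeff: "fact (Suc m) * ((- a) gchoose Suc m) = fact m * ((- a) gchoose m) * (- a - real m)"
      using gbinomial_mult_1[of "- a" m] by (simp add: algebra_simps)
    have "- a - real (Suc m) = - a - real m - 1" by simp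
    then have "D (Suc m) t = fact m * ((- a) gchoose m) * ((- a - real m) * (1 + t) powr (- a - real m - 1))"
      unfolding D_def by (simp only: coeff mult.assoc)
    moreover have "DERIV (D m) t :> fact m * ((- a) gchoose m) * ((- a - real m) * (1 + t) powr (- a - real m - 1))"
      unfolding D_def[abs_def] using that by (auto intro!: derivative_eq_intros)
    ultimately show ?thesis by simp
  qed
  then have "\<exists>t. (if u < 0 then u < t \<and> t < 0 else 0 < t \<and> t < u) \<and>
      (1 + u) powr (- a) = (\<Sum>m<6. D m 0 / fact m * (u - 0) ^ m) + D 6 t / fact 6 * (u - 0) ^ 6"
    using assms False
    by (intro Taylor[of 6 D _ "min u 0" "max u 0"]) (auto simp: D_def)
  then obtain t where t: "(1 + u) powr (- a) = (\<Sum>m<6. D m 0 / fact m * u ^ m) + D 6 t / fact 6 * u ^ 6"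
    by auto
  have "fact 6 * ((- a) gchoose 6) = a * (a + 1) * (a + 2) * (a + 3) * (a + 4) * (a + 5)"
    by (simp add: gbinomial_prod_rev numeral_eq_Suc algebra_simps)
  also have "\<dots> > 0" using \<open>a > 0\<close> by simp
  finally have "D 6 t \<ge> 0" by (simp add: D_def)
  then have "D 6 t / fact 6 * u ^ 6 \<ge> 0" by simp
  moreover have "(\<Sum>m<6. D m 0 / fact m * u ^ m) = (\<Sum>m<6. ((- a) gchoose m) * u ^ m)"
    by (intro sum.cong) (auto simp: D_def)
  ultimately show ?thesis using t by simp
qed

text \<open>Polynomials as coefficient lists, constant term first.\<close>

primrec horner :: "int list \<Rightarrow> real \<Rightarrow> real" where
  "horner [] x = 0"
| "horner (c # p) x = real_of_int c + x * horner p x"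

fun list_add :: "int list \<Rightarrow> int list \<Rightarrow> int list" where
  "list_add [] q = q"
| "list_add (c # p) [] = c # p"
| "list_add (c # p) (d # q) = (c + d) # list_add p q"

primrec list_mult :: "int list \<Rightarrow> int list \<Rightarrow> int list" where
  "list_mult [] q = []"
| "list_mult (c # p) q = list_add (map ((*) c) q) (0 # list_mult p q)"

primrec list_power :: "int list \<Rightarrow> nat \<Rightarrow> int list" where
  "list_power p 0 = [1]"
| "list_power p (Suc n) = list_mult p (list_power p n)"

text \<open>\<open>homogenized c p q\<close> represents \<open>\<Sum>k\<le>n. c ! k * p ^ k * q ^ (n - k)\<close> with \<open>n = length c - 1\<close>.\<close>

primrec homogenized :: "int list \<Rightarrow> int list \<Rightarrow> int list \<Rightarrow> int list" where
  "homogenized [] p q = []"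
| "homogenized (c # cs) p q =
     list_add (map ((*) c) (list_power q (length cs))) (list_mult p (homogenized cs p q))"

lemma horner_add: "horner (list_add p q) x = horner p x + horner q x"
  by (induction p q rule: list_add.induct) (auto simp: algebra_simps)

lemma horner_smult: "horner (map ((*) c) p) x = real_of_int c * horner p x"
  by (induction p) (auto simp: algebra_simps)

lemma horner_mult: "horner (list_mult p q) x = horner p x * horner q x"
  by (induction p) (auto simp: horner_add horner_smult algebra_simps)

lemma horner_power: "horner (list_power p n) x = horner p x ^ n"
  by (induction n) (auto simp: horner_mult)

lemma horner_homogenized:
  assumes "horner q x \<noteq> 0" "length c = Suc n"
  shows "horner (homogenized c p q) x = horner c (horner p x / horner q x) * horner q x ^ n"
  using assms(2)
proof (induction c arbitrary: n)
  case (Cons a c)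
  show ?case
  proof (cases c)
    case Nil
    then show ?thesis using Cons by (simp add: horner_add horner_mult horner_power horner_smult)
  next
    case (Cons b c')
    then obtain m where m: "n = Suc m" "length c = Suc m" using Cons.prems by auto
    from Cons.IH[OF m(2)] show ?thesis
      using assms(1) Cons.prems m
      by (simp add: horner_add horner_mult horner_power horner_smult field_simps)
  qed
qed simp

lemma horner_nonneg: "list_all (\<lambda>c. 0 \<le> c) p \<Longrightarrow> x \<ge> 0 \<Longrightarrow> horner p x \<ge> 0"
  by (induction p) auto


text \<open>
  Obtained from the leading eigenfunction of the transfer operator by interpolation at
  Chebyshev nodes, scaled by \<open>10\<^sup>7\<close>. With \<open>s = 552/1039\<close> we have
  \<open>t powr (- 2 * s) = t powr (- 65/1039) / t\<close>, and the small exponent makes Taylor polynomials accurate.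
\<close>

definition eigen_coeffs :: "int list" where
  "eigen_coeffs = [12938782, -7616982, 4451844, -2367280, 937646, -190234]"

text \<open>The binomial coefficients of \<open>- 65/1039\<close> times \<open>5! * 1039^5 = 145297781691503880\<close>.\<close>

definition taylor_coeffs :: "int list" where
  "taylor_coeffs = [145297781691503880, -9089851597639800, 4829257056686400,
     -3320211059505600, 2542086523423200, -2065475883612960]"

text \<open>Expansion around \<open>\<tau>\<close> with \<open>t = \<tau> * (1 + u)\<close>;
  \<open>\<kappa>\<close> stands for a rational lower bound of the value at
  \<open>\<tau>\<close>.\<close>

lemma powr_ge_taylor_coeffs:
  fixes t \<tau> \<kappa> :: real
  assumes "t > 0" "\<tau> > 0" "\<kappa> \<ge> 0" "\<kappa> \<le> \<tau> powr (- (65/1039))"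
  shows "\<kappa> * (horner taylor_coeffs (t / \<tau> - 1) / 145297781691503880) \<le> t powr (- (65/1039))"
proof -
  define u where "u = t / \<tau> - 1"
  have "u > -1" using assms by (simp add: u_def)
  have "horner taylor_coeffs u / 145297781691503880 = (\<Sum>k<6. ((- (65/1039)) gchoose k) * u ^ k)"
    by (simp add: taylor_coeffs_def gbinomial_prod_rev numeral_eq_Suc) (simp add: field_simps)
  also have "\<dots> \<le> (1 + u) powr (- (65/1039))"
    using \<open>u > -1\<close> by (intro powr_neg_ge_taylor) auto
  finally have "\<kappa> * (horner taylor_coeffs u / 145297781691503880) \<le> \<kappa> * (1 + u) powr (- (65/1039))"
    using assms by (intro mult_left_mono) auto
  also have "\<dots> \<le> \<tau> powr (- (65/1039)) * (1 + u) powr (- (65/1039))"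
    using assms by (intro mult_right_mono) auto
  also have "\<dots> = t powr (- (65/1039))"
    using assms \<open>u > -1\<close> by (simp add: u_def flip: powr_mult)
  finally show ?thesis by (simp add: u_def)
qed

text \<open>The expansion points correspond to \<open>x = 14/25\<close>, near the middle of \<^const>\<open>cf_interval\<close>.\<close>

lemma kappa_bound_1: "97256378 / 10^8 \<le> (39/25 :: real) powr (- (65/1039))"
proof -
  have 1: "ln (39/25 :: real) \<le> 44468583 / 10^8"
    using ln_approx_bounds[of "39/25" 5] by (simp add: eval_nat_numeral)
  \<comment> \<open>The reciprocal exceeds 1, so its logarithm is positive and the series bounds
    apply to it.\<close>
  have 2: "27819620 / 10^9 \<le> ln (10^8 / 97256378 :: real)"
    using ln_approx_bounds[of "10^8 / 97256378" 3] by (simp add: eval_nat_numeral)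
  have "ln (97256378 / 10^8 :: real) = - ln (10^8 / 97256378)"
    by (simp add: ln_div)
  also have "\<dots> \<le> - (65/1039) * ln (39/25)" using 1 2 by simp
  also have "\<dots> = ln ((39/25) powr (- (65/1039)))" by (simp add: ln_powr)
  finally show ?thesis by (subst (asm) ln_le_cancel_iff) auto
qed

lemma kappa_bound_2: "94288872 / 10^8 \<le> (64/25 :: real) powr (- (65/1039))"
proof -
  have 1: "ln (64/25 :: real) \<le> 94000727 / 10^8"
    using ln_approx_bounds[of "64/25" 10] by (simp add: eval_nat_numeral)
  have 2: "58807005 / 10^9 \<le> ln (10^8 / 94288872 :: real)"
    using ln_approx_bounds[of "10^8 / 94288872" 3] by (simp add: eval_nat_numeral)
  have "ln (94288872 / 10^8 :: real) = - ln (10^8 / 94288872)"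
    by (simp add: ln_div)
  also have "\<dots> \<le> - (65/1039) * ln (64/25)" using 1 2 by simp
  also have "\<dots> = ln ((64/25) powr (- (65/1039)))" by (simp add: ln_powr)
  finally show ?thesis by (subst (asm) ln_le_cancel_iff) auto
qed

text \<open>
  The substitution \<open>x = (9 + 19 * z) / (25 * (1 + z))\<close> maps \<open>z \<ge> 0\<close> onto \<open>[9/25, 19/25)\<close>;
  after clearing denominators all coefficients in \<open>z\<close> turn out to be positive.
\<close>

lemma eigen_polynomial_inequality:
  assumes "x \<in> cf_interval"
  shows "10^8 * 145297781691503880 * horner eigen_coeffs x \<le>
    97256378 * horner taylor_coeffs ((1 + x) / (39/25) - 1) * horner eigen_coeffs (1 / (1 + x)) / (1 + x) +
    94288872 * horner taylor_coeffs ((2 + x) / (64/25) - 1) * horner eigen_coeffs (1 / (2 + x)) / (2 + x)"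
    (is "?l \<le> ?r")
proof -
  define z where "z = (25 * x - 9) / (19 - 25 * x)"
  have x: "x \<ge> 4/11" "x \<le> 3/4" using assms by (auto simp: cf_interval_def)
  then have "z \<ge> 0" by (simp add: z_def)
  define h where "h = horner [25, 25] z"
  define X where "X = horner [9, 19] z"
  define A where "A = horner [34, 44] z"
  define B where "B = horner [59, 69] z"
  have h: "h > 0" "A > 0" "B > 0" using \<open>z \<ge> 0\<close> by (auto simp: h_def A_def B_def)
  have ratio: "X / h = x" "A / h = 1 + x" "B / h = 2 + x"
    using x by (simp_all add: X_def A_def B_def h_def z_def field_simps)
  let ?h = "[25, 25] :: int list" and ?X = "[9, 19] :: int list" and ?A = "[34, 44] :: int list"
    and ?B = "[59, 69] :: int list"
  let ?V1 = "map ((*) 39) ?h" and ?V2 = "map ((*) 64) ?h"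
  let ?U1 = "list_add (map ((*) 25) ?A) (map ((*) (-39)) ?h)"
  let ?U2 = "list_add (map ((*) 25) ?B) (map ((*) (-64)) ?h)"
  define P1 where "P1 = map ((*) (97256378 * 64^5)) (list_mult (list_mult (homogenized taylor_coeffs ?U1 ?V1)
    (homogenized eigen_coeffs ?h ?A)) (list_mult ?h (list_power ?B 6)))"
  define P2 where "P2 = map ((*) (94288872 * 39^5)) (list_mult (list_mult (homogenized taylor_coeffs ?U2 ?V2)
    (homogenized eigen_coeffs ?h ?B)) (list_mult ?h (list_power ?A 6)))"
  define P3 where "P3 = map ((*) (- (10^8 * 145297781691503880 * 39^5 * 64^5)))
    (list_mult (homogenized eigen_coeffs ?X ?h) (list_mult (list_power ?A 6) (list_power ?B 6)))"
  \<comment> \<open>The common denominator. The Taylor parts need \<open>(39 * h)^5\<close> and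
    \<open>(64 * h)^5\<close>; \<open>A\<close> and \<open>B\<close> occur to the fifth power in
    \<open>h / A\<close> and \<open>h / B\<close> and once more through \<open>1 / (1 + x)\<close>
    and \<open>1 / (2 + x)\<close>.\<close>
  define N where "N = 39^5 * 64^5 * h^5 * A^6 * B^6"
  have len: "length taylor_coeffs = Suc 5" "length eigen_coeffs = Suc 5"
    by (simp_all add: taylor_coeffs_def eigen_coeffs_def)
  have "list_all (\<lambda>c. 0 \<le> c) (list_add P1 (list_add P2 P3))"
    unfolding P1_def P2_def P3_def by code_simp
  then have "horner (list_add P1 (list_add P2 P3)) z \<ge> 0" using \<open>z \<ge> 0\<close> by (rule horner_nonneg)
  then have sum: "horner P1 z + horner P2 z + horner P3 z \<ge> 0" by (simp add: horner_add)
  have hz: "horner ?h z = h" "horner ?X z = X" "horner ?A z = A" "horner ?B z = B"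
    by (simp_all only: h_def X_def A_def B_def)
  have nz: "horner ?h z \<noteq> 0" "horner ?A z \<noteq> 0" "horner ?B z \<noteq> 0" "horner ?V1 z \<noteq> 0" "horner ?V2 z \<noteq> 0"
    using h hz horner_smult[of 39 ?h z] horner_smult[of 64 ?h z] by auto
  have V: "horner ?V1 z = 39 * h" "horner ?V2 z = 64 * h"
    using hz horner_smult[of 39 ?h z] horner_smult[of 64 ?h z] by auto
  have U: "horner ?U1 z / horner ?V1 z = (1 + x) / (39/25) - 1"
    "horner ?U2 z / horner ?V2 z = (2 + x) / (64/25) - 1"
    unfolding V unfolding horner_add horner_smult hz ratio(2,3)[symmetric] using h by (simp_all add: field_simps)
  have inv: "h / A = 1 / (1 + x)" "h / B = 1 / (2 + x)"
    using h by (simp_all flip: ratio(2,3))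
  define T1 T2 where "T1 = horner taylor_coeffs ((1 + x) / (39/25) - 1)"
    and "T2 = horner taylor_coeffs ((2 + x) / (64/25) - 1)"
  define E1 E2 where "E1 = horner eigen_coeffs (1 / (1 + x))" and "E2 = horner eigen_coeffs (1 / (2 + x))"
  have "horner P1 z = N * (97256378 * T1 * E1 * (h / A))"
    unfolding P1_def unfolding horner_smult horner_mult horner_power
    unfolding horner_homogenized[OF nz(4) len(1)] horner_homogenized[OF nz(2) len(2)]
    unfolding U unfolding V hz inv T1_def[symmetric] E1_def[symmetric] unfolding inv[symmetric] N_def
    using h by (simp add: field_simps eval_nat_numeral)
  then have 1: "horner P1 z = N * (97256378 * T1 * E1 / (1 + x))" by (simp add: inv)
  have "horner P2 z = N * (94288872 * T2 * E2 * (h / B))"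
    unfolding P2_def unfolding horner_smult horner_mult horner_power
    unfolding horner_homogenized[OF nz(5) len(1)] horner_homogenized[OF nz(3) len(2)]
    unfolding U unfolding V hz inv T2_def[symmetric] E2_def[symmetric] unfolding inv[symmetric] N_def
    using h by (simp add: field_simps eval_nat_numeral)
  then have 2: "horner P2 z = N * (94288872 * T2 * E2 / (2 + x))" by (simp add: inv)
  have 3: "horner P3 z = N * - ?l"
    unfolding P3_def unfolding horner_smult horner_mult horner_power
    unfolding horner_homogenized[OF nz(1) len(2)] unfolding hz ratio N_def
    by (simp add: mult_ac)
  have "N * (?r - ?l) \<ge> 0"
    using sum unfolding 1 2 3 T1_def T2_def E1_def E2_def by (simp only: distrib_left diff_conv_add_uminus)
  moreover have "N > 0" using h by (simp add: N_def)
  ultimately show ?thesis by (simp add: zero_le_mult_iff)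
qed

text \<open>The upper bound is twice the lower one, which yields the constant 2 of
  \<open>f_harnack\<close>. The lower bound is the linear part at \<open>3/4\<close>, rounded
  down.\<close>

lemma eigen_bounds:
  assumes "x \<in> cf_interval"
  shows "7226045 \<le> horner eigen_coeffs x" "horner eigen_coeffs x \<le> 14452090"
proof -
  have x: "x \<ge> 4/11" "x \<le> 3/4" using assms by (auto simp: cf_interval_def)
  have eq: "horner eigen_coeffs x = 12938782 - 7616982 * x + x^2 * (4451844 - 2367280 * x) + x^4 * (937646 - 190234 * x)"
    by (simp add: eigen_coeffs_def eval_nat_numeral algebra_simps)
  have "x^2 * (4451844 - 2367280 * x) \<ge> 0" "x^4 * (937646 - 190234 * x) \<ge> 0"
    using x by (auto intro!: mult_nonneg_nonneg)
  then show "7226045 \<le> horner eigen_coeffs x" unfolding eq using x by linarith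
  have "x^2 \<le> (3/4)^2" "x^4 \<le> (3/4)^4" using x by (auto intro!: power_mono)
  then have "x^2 * (4451844 - 2367280 * x) \<le> (3/4)^2 * 4451844" "x^4 * (937646 - 190234 * x) \<le> (3/4)^4 * 937646"
    using x by (auto intro!: mult_mono)
  then show "horner eigen_coeffs x \<le> 14452090" unfolding eq using x by (simp add: power_divide)
qed

interpretation cf12: subinvariant "552/1039" "horner eigen_coeffs"
proof
  show "(552/1039::real) > 0" by simp
  show "horner eigen_coeffs x > 0" if "x \<in> cf_interval" for x
    using eigen_bounds[OF that] by linarith
  show "horner eigen_coeffs x \<le> 2 * horner eigen_coeffs y" if "x \<in> cf_interval" "y \<in> cf_interval" for x y
    using eigen_bounds[OF that(1)] eigen_bounds[OF that(2)] by linarith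
  fix x assume x: "x \<in> cf_interval"
  then have x': "x > 0" by (auto simp: cf_interval_def)
  have mem: "1 / (1 + x) \<in> cf_interval" "1 / (2 + x) \<in> cf_interval"
    using cf_mobius_mem[of "[1]" x] cf_mobius_mem[of "[2]" x] x by auto
  have split: "t powr (- 2 * (552/1039)) = t powr (- (65/1039)) / t" if "t > 0" for t :: real
  proof -
    have "t powr (- 2 * (552/1039)) = t powr (- (65/1039) + - 1)" by simp
    also have "\<dots> = t powr (- (65/1039)) * t powr (- 1)" by (rule powr_add)
    also have "t powr (- 1) = 1 / t" using that by (simp add: powr_minus divide_inverse)
    finally show ?thesis by simp
  qed
  have term_bound: "K * horner taylor_coeffs (t / \<tau> - 1) * horner eigen_coeffs (1 / t) / t
      \<le> 10^8 * 145297781691503880 * (t powr (- 2 * (552/1039)) * horner eigen_coeffs (1 / t))"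
    if "K / 10^8 \<le> \<tau> powr (- (65/1039))" "t > 0" "1 / t \<in> cf_interval" "\<tau> > 0" "K \<ge> 0" for t \<tau> K :: real
  proof -
    have "K * horner taylor_coeffs (t / \<tau> - 1) \<le> 10^8 * 145297781691503880 * t powr (- (65/1039))"
      using powr_ge_taylor_coeffs[OF that(2,4) _ that(1)] that(5) by simp
    then have "K * horner taylor_coeffs (t / \<tau> - 1) * (horner eigen_coeffs (1 / t) / t) \<le>
        10^8 * 145297781691503880 * t powr (- (65/1039)) * (horner eigen_coeffs (1 / t) / t)"
      using eigen_bounds(1)[OF that(3)] that(2) by (intro mult_right_mono) auto
    then show ?thesis unfolding split[OF that(2)] by (simp add: mult_ac)
  qed
  have "1 + x > 0" "2 + x > 0" using x' by auto
  from term_bound[OF kappa_bound_1 this(1) mem(1)] term_bound[OF kappa_bound_2 this(2) mem(2)]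
  have "10^8 * 145297781691503880 * horner eigen_coeffs x \<le>
      10^8 * 145297781691503880 * ((1 + x) powr (- 2 * (552/1039)) * horner eigen_coeffs (1 / (1 + x))) +
      10^8 * 145297781691503880 * ((2 + x) powr (- 2 * (552/1039)) * horner eigen_coeffs (1 / (2 + x)))"
    using eigen_polynomial_inequality[OF x] by linarith
  then have "10^8 * 145297781691503880 * horner eigen_coeffs x \<le> 10^8 * 145297781691503880 *
      ((1 + x) powr (- 2 * (552/1039)) * horner eigen_coeffs (1 / (1 + x)) +
       (2 + x) powr (- 2 * (552/1039)) * horner eigen_coeffs (1 / (2 + x)))"
    by (simp only: distrib_left)
  then show "horner eigen_coeffs x \<le> (1 + x) powr (- 2 * (552/1039)) * horner eigen_coeffs (1 / (1 + x)) +
      (2 + x) powr (- 2 * (552/1039)) * horner eigen_coeffs (1 / (2 + x))"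
    by (rule mult_left_le_imp_le) simp
qed

section \<open>A gap of the Lagrange spectrum\<close>

text \<open>The periodic sequence \<open>3 2 2 2 1 2 3\<close>, positioned such that the largest values occur at multiples of 7.\<close>

definition per :: "int \<Rightarrow> nat" where
  "per k = [3, 2, 2, 2, 1, 2, 3] ! nat (k mod 7)"

lemma per_shift: "per (k + 7 * j) = per k"
  by (simp add: per_def)

lemma per_shift_left: "per (k - 7 * j) = per k" "per (k - 7) = per k"
  using per_shift[of k "- j"] per_shift[of k "- 1"] by simp_all

lemma per_range: "per k \<in> {1, 2, 3}"
proof -
  have "k mod 7 \<in> {0, 1, 2, 3, 4, 5, 6}" using pos_mod_bound[of 7 k] pos_mod_sign[of 7 k] by auto
  then show ?thesis by (auto simp: per_def nat_numeral)
qed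

lemma digits_right_iff: "digits_right a n R \<longleftrightarrow> (\<forall>k < length R. int (a (n + 1 + int k)) = R ! k)"
proof (induction R arbitrary: n)
  case (Cons r R)
  show ?case by (simp add: Cons.IH All_less_Suc2 add_ac)
qed simp

lemma digits_left_iff: "digits_left a n L \<longleftrightarrow> (\<forall>k < length L. int (a (n - 1 - int k)) = L ! k)"
proof (induction L arbitrary: n)
  case (Cons r R)
  show ?case by (simp add: Cons.IH All_less_Suc2 algebra_simps)
qed simp

definition right_of :: "(int \<Rightarrow> nat) \<Rightarrow> int \<Rightarrow> nat \<Rightarrow> int list" where
  "right_of g i l = map (\<lambda>k. int (g (i + 1 + int k))) [0..<l]"

definition left_of :: "(int \<Rightarrow> nat) \<Rightarrow> int \<Rightarrow> nat \<Rightarrow> int list" where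
  "left_of g i l = map (\<lambda>k. int (g (i - 1 - int k))) [0..<l]"

lemma int_interval_shift: "(\<forall>k < l. P (int k + 1)) \<longleftrightarrow> (\<forall>k \<in> {1..int l}. P k)"
proof -
  have eq: "{1..int l} = (\<lambda>k. int k + 1) ` {..<l}"
  proof
    show "{1..int l} \<subseteq> (\<lambda>k. int k + 1) ` {..<l}"
    proof
      fix k assume "k \<in> {1..int l}"
      then show "k \<in> (\<lambda>k. int k + 1) ` {..<l}" by (intro image_eqI[of _ _ "nat (k - 1)"]) auto
    qed
  qed auto
  show ?thesis unfolding eq by auto
qed

lemma digits_right_of: "digits_right a n (right_of g i l) \<longleftrightarrow> (\<forall>k \<in> {1..int l}. a (n + k) = g (i + k))"
  using int_interval_shift[of l "\<lambda>k. a (n + k) = g (i + k)"]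
  by (simp add: digits_right_iff right_of_def add_ac)

lemma digits_left_of: "digits_left a n (left_of g i l) \<longleftrightarrow> (\<forall>k \<in> {1..int l}. a (n - k) = g (i - k))"
  using int_interval_shift[of l "\<lambda>k. a (n - k) = g (i - k)"]
  by (simp add: digits_left_iff left_of_def algebra_simps)

abbreviation (input) "T0 \<equiv> 3709699859750"
abbreviation (input) "T1 \<equiv> 3709699859751"

text \<open>The range is the one forced by \<open>search_core\<close>. One period further left, 10
  left digits are still known and \<open>search_replication\<close> supplies the missing 7.\<close>

definition agree :: "(int \<Rightarrow> nat) \<Rightarrow> int \<Rightarrow> bool" where
  "agree a n \<longleftrightarrow> (\<forall>k \<in> {-17..12}. a (n + k) = per k)"

lemma agree_iff:
  "agree a n \<longleftrightarrow> digits_left a n (left_of per 0 17) \<and> a n = 3 \<and> digits_right a n (right_of per 0 12)"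
proof
  assume "agree a n"
  then have a: "a (n + k) = per k" if "k \<in> {-17..12}" for k using that unfolding agree_def by blast
  have "a n = 3" using a[of 0] by (simp add: per_def)
  moreover have "digits_left a n (left_of per 0 17)" unfolding digits_left_of using a[of "- k" for k] by simp
  moreover have "digits_right a n (right_of per 0 12)" unfolding digits_right_of using a by simp
  ultimately show "digits_left a n (left_of per 0 17) \<and> a n = 3 \<and> digits_right a n (right_of per 0 12)"
    by blast
next
  assume *: "digits_left a n (left_of per 0 17) \<and> a n = 3 \<and> digits_right a n (right_of per 0 12)"
  show "agree a n"
    unfolding agree_def
  proof
    fix k :: int assume k: "k \<in> {-17..12}"
    consider "k < 0" | "k = 0" | "k > 0" by linarith
    then show "a (n + k) = per k"
    proof cases
      case 1
      then have "- k \<in> {1..int 17}" using k by simp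
      then have "a (n - (- k)) = per (0 - (- k))" using * unfolding digits_left_of by blast
      then show ?thesis by simp
    next
      case 2
      then show ?thesis using * by (simp add: per_def)
    next
      case 3
      then show ?thesis using * k unfolding digits_right_of by simp
    qed
  qed
qed

lemma core_lists:
  "left_of per 0 17 = [3, 2, 1, 2, 2, 2, 3, 3, 2, 1, 2, 2, 2, 3, 3, 2, 1]"
  "left_of per 0 10 = [3, 2, 1, 2, 2, 2, 3, 3, 2, 1]"
  "right_of per 0 12 = [2, 2, 2, 1, 2, 3, 3, 2, 2, 2, 1, 2]"
  "right_of per 0 19 = [2, 2, 2, 1, 2, 3, 3, 2, 2, 2, 1, 2, 3, 3, 2, 2, 2, 1, 2]"
  by (code_simp)+

text \<open>Without goals every branch must end in a contradiction, which excludes the centre digits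
  1 and 2.\<close>

lemma search_small_centre: "search 8 T0 T1 [] [] 1 []" "search 8 T0 T1 [] [] 2 []"
  by code_simp+

text \<open>The two goals are mirror images, since values do not depend on the orientation.\<close>

lemma search_core:
  "search 40 T0 T1
     [([3, 2, 1, 2, 2, 2, 3, 3, 2, 1, 2, 2, 2, 3, 3, 2, 1], [2, 2, 2, 1, 2, 3, 3, 2, 2, 2, 1, 2]),
      ([2, 2, 2, 1, 2, 3, 3, 2, 2, 2, 1, 2], [3, 2, 1, 2, 2, 2, 3, 3, 2, 1, 2, 2, 2, 3, 3, 2, 1])] [] 3 []"
  by code_simp

text \<open>The lower threshold 0 never closes a branch, because values are positive: only the upper
  bound \<open>T1\<close> forces the next period on the left.\<close>

lemma search_replication:
  "search 8 0 T1 [([3, 2, 1, 2, 2, 2, 3, 3, 2, 1, 2, 2, 2, 3, 3, 2, 1], [])]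
     [3, 2, 1, 2, 2, 2, 3, 3, 2, 1] 3 [2, 2, 2, 1, 2, 3, 3, 2, 2, 2, 1, 2, 3, 3, 2, 2, 2, 1, 2]"
  by code_simp

text \<open>\<open>T0\<close> lies far enough above the periodic Markov value for 15 digits on each
  side to suffice.\<close>

lemma periodic_windows_below:
  "lambda_below T0 (left_of per 0 15) (int (per 0)) (right_of per 0 15)"
  "lambda_below T0 (left_of per 1 15) (int (per 1)) (right_of per 1 15)"
  "lambda_below T0 (left_of per 2 15) (int (per 2)) (right_of per 2 15)"
  "lambda_below T0 (left_of per 3 15) (int (per 3)) (right_of per 3 15)"
  "lambda_below T0 (left_of per 4 15) (int (per 4)) (right_of per 4 15)"
  "lambda_below T0 (left_of per 5 15) (int (per 5)) (right_of per 5 15)"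
  "lambda_below T0 (left_of per 6 15) (int (per 6)) (right_of per 6 15)"
  by code_simp+

lemma digit_le_3:
  assumes "\<forall>i. a i > 0" "cf_lambda a i < real_of_int T1 / 10^12"
  shows "a i \<le> 3"
  using cf_lambda_gt_digit[OF assms(1), of i] assms(2) by simp

text \<open>The radius 50 leaves room for the fuel 40 of \<open>search_core\<close>.\<close>

lemma large_value_core:
  assumes pos: "\<forall>i. a i > 0" and bnd: "\<forall>i \<in> {n - 50..n + 50}. cf_lambda a i < real_of_int T1 / 10^12"
    and low: "cf_lambda a n \<ge> real_of_int T0 / 10^12"
  shows "agree a n \<or> agree (\<lambda>i. a (- i)) (- n)"
proof -
  have "a (n - 1) \<le> 3" "a (n + 1) \<le> 3" using digit_le_3[OF pos] bnd by auto
  then have w: "window a n [] (int (a n)) []" by (simp add: window_def)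
  have "a n \<le> 3" "a n > 0" using digit_le_3[OF pos] bnd pos by auto
  then consider "a n = 1" | "a n = 2" | "a n = 3" by linarith
  then show ?thesis
  proof cases
    case 1
    then show ?thesis using search_sound[OF pos w _ bnd _ _ _ low, of 8 "[]"] search_small_centre(1) by simp
  next
    case 2
    then show ?thesis using search_sound[OF pos w _ bnd _ _ _ low, of 8 "[]"] search_small_centre(2) by simp
  next
    case 3
    have "\<exists>(gl, gr) \<in> set [(left_of per 0 17, right_of per 0 12), (right_of per 0 12, left_of per 0 17)].
        digits_left a n gl \<and> digits_right a n gr"
      using search_core 3
      by (intro search_sound[OF pos w _ bnd _ _ _ low, of 40]) (simp_all add: core_lists)
    then show ?thesis
      using 3 by (auto simp: agree_iff digits_left_reverse digits_right_reverse)
  qed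
qed

lemma agree_replicates:
  assumes pos: "\<forall>i. a i > 0" and bnd: "\<forall>i \<in> {n - 37..n + 23}. cf_lambda a i < real_of_int T1 / 10^12"
    and "agree a n"
  shows "agree a (n - 7)"
proof -
  have known: "a (n - 7 + k) = per k" if "k \<in> {-10..19}" for k
  proof -
    have "a (n + (k - 7)) = per (k - 7)" using assms(3) that unfolding agree_def by auto
    then show ?thesis by (simp only: per_shift_left) (simp add: algebra_simps)
  qed
  have "a (n - 7) = 3" using known[of 0] by (simp add: per_def)
  moreover have "digits_left a (n - 7) (left_of per 0 10)"
    unfolding digits_left_of using known[of "- k" for k] by simp
  moreover have R: "digits_right a (n - 7) (right_of per 0 19)"
    unfolding digits_right_of using known by simp
  moreover have "a (n - 7 - 1 - 10) \<le> 3" "a (n - 7 + 1 + 19) \<le> 3"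
    using digit_le_3[OF pos] bnd by auto
  ultimately have w: "window a (n - 7) (left_of per 0 10) 3 (right_of per 0 19)"
    by (simp add: window_def left_of_def[of _ _ 10] right_of_def[of _ _ 19])
  \<comment> \<open>Radius 30 about the new centre covers 19 known digits on the right plus fuel
    8.\<close>
  have bnd': "\<forall>i \<in> {n - 7 - 30..n - 7 + 30}. cf_lambda a i < real_of_int T1 / 10^12" using bnd by auto
  have "cf_lambda a (n - 7) \<ge> real_of_int 0 / 10^12"
    using cf_lambda_gt_digit[OF pos, of "n - 7"] by simp
  from search_sound[OF pos w _ bnd' _ _ _ this, of 8 "[(left_of per 0 17, [])]"] search_replication
  have "digits_left a (n - 7) (left_of per 0 17)" by (simp add: core_lists)
  moreover have "digits_right a (n - 7) (right_of per 0 12)" using known unfolding digits_right_of by simp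
  ultimately show ?thesis using \<open>a (n - 7) = 3\<close> by (simp add: agree_iff)
qed

lemma agree_propagates:
  assumes pos: "\<forall>i. a i > 0" and "agree a n"
    and "\<forall>i \<in> {n - 7 * int j - 40..n + 40}. cf_lambda a i < real_of_int T1 / 10^12"
  shows "\<forall>k \<in> {- 7 * int j - 17..12}. a (n + k) = per k"
  using assms(3)
proof (induction j)
  case 0
  then show ?case using assms(2) by (simp add: agree_def)
next
  case (Suc j)
  have IH: "a (n + k) = per k" if "k \<in> {- 7 * int j - 17..12}" for k
    using Suc.IH Suc.prems that by auto
  have "agree a (n - 7 * int j)"
    unfolding agree_def
  proof
    fix k :: int assume "k \<in> {-17..12}"
    then have "a (n + (k - 7 * int j)) = per (k - 7 * int j)" by (intro IH) auto
    then show "a (n - 7 * int j + k) = per k" by (simp only: per_shift_left) (simp add: algebra_simps)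
  qed
  then have ag: "agree a (n - 7 * int j - 7)"
    using Suc.prems by (intro agree_replicates[OF pos]) auto
  show ?case
  proof
    fix k :: int assume k: "k \<in> {- 7 * int (Suc j) - 17..12}"
    show "a (n + k) = per k"
    proof (cases "k \<ge> - 7 * int j - 17")
      case True
      then show ?thesis using IH k by auto
    next
      case False
      then have "k + 7 * (int j + 1) \<in> {-17..12}" using k by auto
      then have "a (n - 7 * int j - 7 + (k + 7 * (int j + 1))) = per (k + 7 * (int j + 1))"
        using ag unfolding agree_def by blast
      then show ?thesis by (simp only: per_shift) (simp add: algebra_simps)
    qed
  qed
qed

lemma periodic_value_below:
  assumes pos: "\<forall>i. a i > 0" and per: "\<forall>k \<in> {-16..16}. a (i + k) = per (i - m + k)"
  shows "cf_lambda a i < real_of_int T0 / 10^12"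
proof -
  define r where "r = (i - m) mod 7"
  have r: "r \<in> set [0, 1, 2, 3, 4, 5, 6]"
    using pos_mod_bound[of 7 "i - m"] pos_mod_sign[of 7 "i - m"] by (auto simp: r_def)
  have "per (i - m + k) = per (r + k)" for k by (simp add: per_def r_def mod_add_left_eq)
  then have a: "a (i + k) = per (r + k)" if "k \<in> {-16..16}" for k using per that by simp
  have "digits_right a i (right_of per r 15)" unfolding digits_right_of using a by simp
  moreover have "digits_left a i (left_of per r 15)"
    unfolding digits_left_of using a[of "- k" for k] by simp
  moreover have "a i = per r" using a[of 0] by simp
  \<comment> \<open>The digits at distance 16 lie just outside the lists and only need to be at most
    3.\<close>
  moreover have "a (i - 1 - 15) \<le> 3" "a (i + 1 + 15) \<le> 3"
    using a[of "-16"] a[of 16] per_range[of "r - 16"] per_range[of "r + 16"]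
    by (auto simp: add.commute[of i])
  ultimately have "window a i (left_of per r 15) (int (per r)) (right_of per r 15)"
    by (simp add: window_def left_of_def[of _ _ 15] right_of_def[of _ _ 15])
  moreover have "lambda_below T0 (left_of per r 15) (int (per r)) (right_of per r 15)"
    using periodic_windows_below r by auto
  ultimately show ?thesis by (rule lambda_below_sound[OF pos])
qed

theorem lagrange_gap:
  assumes "real_of_int T0 / 10^12 < x" "x < real_of_int T1 / 10^12"
  shows "x \<notin> lagrange_spectrum"
proof
  assume "x \<in> lagrange_spectrum"
  then obtain a where pos: "\<forall>i. a i > 0" and lim: "limsup (\<lambda>n. ereal (cf_lambda a (int n))) = ereal x"
    unfolding lagrange_spectrum_def lagrange_value_def by blast
  have "limsup (\<lambda>n. ereal (cf_lambda a (int n))) < ereal (real_of_int T1 / 10^12)"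
    using assms(2) by (simp add: lim)
  then have "\<forall>\<^sub>F n in sequentially. ereal (cf_lambda a (int n)) < ereal (real_of_int T1 / 10^12)"
    by (rule Limsup_lessD)
  then obtain N0 where N0: "\<And>n. n \<ge> N0 \<Longrightarrow> cf_lambda a (int n) < real_of_int T1 / 10^12"
    by (auto simp: eventually_sequentially)
  define N where "N = int N0"
  have bnd: "cf_lambda a i < real_of_int T1 / 10^12" if "i \<ge> N" for i
    using N0[of "nat i"] that by (simp add: N_def)
  have freq: "\<exists>n \<ge> M. n \<ge> N + 60 \<and> cf_lambda a n > real_of_int T0 / 10^12" for M
  proof (rule ccontr)
    assume neg: "\<not> ?thesis"
    have "\<forall>\<^sub>F n in sequentially. ereal (cf_lambda a (int n)) \<le> ereal (real_of_int T0 / 10^12)"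
      unfolding eventually_sequentially
    proof (intro exI[of _ "nat (max M (N + 60))"] allI impI)
      fix n assume "nat (max M (N + 60)) \<le> n"
      then have "int n \<ge> M" "int n \<ge> N + 60" by auto
      then show "ereal (cf_lambda a (int n)) \<le> ereal (real_of_int T0 / 10^12)" using neg by force
    qed
    then have "limsup (\<lambda>n. ereal (cf_lambda a (int n))) \<le> ereal (real_of_int T0 / 10^12)"
      by (rule Limsup_bounded)
    then show False using assms(1) by (simp add: lim)
  qed
  have core: "agree a n \<or> agree (\<lambda>i. a (- i)) (- n)"
    if "n \<ge> N + 60" "cf_lambda a n > real_of_int T0 / 10^12" for n
    using large_value_core[OF pos, of n] bnd that by simp
  show False
  proof (cases "\<exists>n \<ge> N + 60. agree (\<lambda>i. a (- i)) (- n)")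
    \<comment> \<open>A reversed pattern replicates to the right forever, since the bound holds from
      \<open>N\<close> on; all sufficiently late values then fall below \<open>T0\<close>.\<close>
    case True
    then obtain n where n: "n \<ge> N + 60" "agree (\<lambda>i. a (- i)) (- n)" by blast
    let ?b = "\<lambda>i. a (- i)"
    have b_pos: "\<forall>i. ?b i > 0" using pos by simp
    have b_per: "?b (- n + k) = per k" if "k \<le> 12" for k
    proof -
      have "\<forall>k \<in> {- 7 * int (nat (- k)) - 17..12}. ?b (- n + k) = per k"
        using n bnd by (intro agree_propagates[OF b_pos n(2)]) (auto simp: cf_lambda_reverse[OF pos])
      then show ?thesis using that by auto
    qed
    obtain n' where n': "n' \<ge> n + 40" "cf_lambda a n' > real_of_int T0 / 10^12" using freq by blast
    have "cf_lambda ?b (- n') < real_of_int T0 / 10^12"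
    proof (rule periodic_value_below[OF b_pos])
      show "\<forall>k \<in> {-16..16}. ?b (- n' + k) = per (- n' - (- n) + k)"
        using b_per[of "- n' - (- n) + k" for k] n' by simp
    qed
    then show False using n' by (simp add: cf_lambda_reverse[OF pos])
  next
    \<comment> \<open>Otherwise a later large position \<open>n2\<close> has the forward pattern,
      which propagates left across the earlier large position \<open>n1\<close> and forces its value
      below \<open>T0\<close>.\<close>
    case False
    obtain n1 where n1: "n1 \<ge> N + 100" "cf_lambda a n1 > real_of_int T0 / 10^12" using freq by blast
    obtain n2 where n2: "n2 \<ge> n1 + 100" "n2 \<ge> N + 60" "cf_lambda a n2 > real_of_int T0 / 10^12"
      using freq by blast
    then have ag: "agree a n2" using core False by blast
    \<comment> \<open>Enough periods to reach beyond \<open>n1\<close>, but by at most 7 positions,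
      so that the bound is still available.\<close>
    define j where "j = nat ((n2 - n1) div 7 + 1)"
    have j: "7 * int j \<ge> n2 - n1 + 1" "7 * int j \<le> n2 - n1 + 7" using n2 by (auto simp: j_def)
    have "\<forall>k \<in> {- 7 * int j - 17..12}. a (n2 + k) = per k"
      using bnd n1 n2 j by (intro agree_propagates[OF pos ag]) auto
    then have "\<forall>k \<in> {-16..16}. a (n1 + k) = per (n1 - n2 + k)"
      using j n2 by (auto dest!: bspec[of _ _ "n1 - n2 + k" for k])
    from periodic_value_below[OF pos this] n1(2) show False by simp
  qed
qed

section \<open>Markov values in the gap\<close>

text \<open>The transition from the periodic left half to an arbitrary sequence over \<open>{1, 2}\<close>.\<close>

definition bridge :: "nat list" where
  "bridge = [2, 2, 2, 1, 2, 3, 3, 2, 2, 2, 1, 2, 2, 1, 2, 1, 2]"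

definition joined :: "(nat \<Rightarrow> nat) \<Rightarrow> int \<Rightarrow> nat" where
  "joined b k = (if k \<le> 0 then per k else if k \<le> 17 then bridge ! nat (k - 1) else b (nat (k - 18)))"

lemma joined_tail: "joined b (18 + int k) = b k"
  by (simp add: joined_def)

lemma joined_cong: "k \<le> 17 \<Longrightarrow> joined b k = joined b' k"
  by (simp add: joined_def)

lemma bridge_range: "k < 17 \<Longrightarrow> bridge ! k \<in> {1, 2, 3}"
  using nth_mem[of k bridge] by (auto simp: bridge_def)

lemma joined_range: "b \<in> binary_seqs \<Longrightarrow> joined b k \<in> {1, 2, 3}"
  using per_range[of k] bridge_range[of "nat (k - 1)"]
  by (auto simp: joined_def binary_seqs_def)

lemma joined_pos:
  assumes "b \<in> binary_seqs"
  shows "\<forall>i. joined b i > 0"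
proof
  show "joined b i > 0" for i using joined_range[OF assms, of i] by auto
qed

lemma joined_le_3: "b \<in> binary_seqs \<Longrightarrow> joined b i \<le> 3"
  using joined_range[of b i] by auto

text \<open>A window ending by position 17 does not see \<open>b\<close>, so the constant sequence 1
  can represent every \<open>b\<close> in computations.\<close>

lemma joined_window:
  assumes "b \<in> binary_seqs" "i + int l \<le> 17"
  shows "window (joined b) i (left_of (joined (\<lambda>_. 1)) i 25) (int (joined (\<lambda>_. 1) i)) (right_of (joined (\<lambda>_. 1)) i l)"
proof -
  have "\<forall>k \<in> {1..int l}. joined b (i + k) = joined (\<lambda>_. 1) (i + k)"
    "\<forall>k \<in> {1..int 25}. joined b (i - k) = joined (\<lambda>_. 1) (i - k)"
    "joined b i = joined (\<lambda>_. 1) i"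
    using assms(2) by (auto intro!: joined_cong)
  then show ?thesis
    using joined_le_3[OF assms(1)] by (simp add: window_def digits_right_of digits_left_of)
qed

definition finite_check :: "int \<Rightarrow> nat \<Rightarrow> bool" where
  "finite_check i l = lambda_below T0 (left_of (joined (\<lambda>_. 1)) i 25) (int (joined (\<lambda>_. 1) i)) (right_of (joined (\<lambda>_. 1)) i l)"

text \<open>Each right list ends at position 17, the last one independent of \<open>b\<close>.
  Position 0 is left out because its value exceeds \<open>T0\<close>.\<close>

lemma finite_checks:
  "finite_check (-15) 32" "finite_check (-14) 31" "finite_check (-13) 30" "finite_check (-12) 29"
  "finite_check (-11) 28" "finite_check (-10) 27" "finite_check (-9) 26" "finite_check (-8) 25"
  "finite_check (-7) 24" "finite_check (-6) 23" "finite_check (-5) 22" "finite_check (-4) 21"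
  "finite_check (-3) 20" "finite_check (-2) 19" "finite_check (-1) 18" "finite_check 1 16"
  "finite_check 2 15" "finite_check 3 14" "finite_check 4 13" "finite_check 5 12"
  "finite_check 6 11" "finite_check 7 10" "finite_check 8 9" "finite_check 9 8"
  "finite_check 10 7" "finite_check 11 6" "finite_check 12 5" "finite_check 13 4"
  "finite_check 14 3" "finite_check 15 2" "finite_check 16 1"
  by code_simp+

lemma finite_check_all: "i \<in> {-15..16} \<Longrightarrow> i \<noteq> 0 \<Longrightarrow> finite_check i (nat (17 - i))"
proof -
  assume i: "i \<in> {-15..16}" "i \<noteq> 0"
  have "{-15..16::int} = {-15, -14, -13, -12, -11, -10, -9, -8, -7, -6, -5, -4, -3, -2, -1, 0, 1, 2, 3, 4, 5, 6,
      7, 8, 9, 10, 11, 12, 13, 14, 15, 16}" by code_simp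
  with i show ?thesis using finite_checks by auto
qed

text \<open>The bridge follows the periodic sequence up to position 12 and departs from it at 13;
  this lifts the centre value above \<open>T0\<close> but not to \<open>T1\<close>, whatever
  follows.\<close>

lemma centre_checks:
  "lambda_above T0 (left_of (joined (\<lambda>_. 1)) 0 25) (int (joined (\<lambda>_. 1) 0)) (right_of (joined (\<lambda>_. 1)) 0 17)"
  "lambda_below T1 (left_of (joined (\<lambda>_. 1)) 0 25) (int (joined (\<lambda>_. 1) 0)) (right_of (joined (\<lambda>_. 1)) 0 17)"
  by code_simp+

lemma small_digit_checks:
  "lambda_below T0 [1] 1 [1]" "lambda_below T0 [1] 1 [2]" "lambda_below T0 [2] 1 [1]" "lambda_below T0 [2] 1 [2]"
  "lambda_below T0 [1] 2 [1]" "lambda_below T0 [1] 2 [2]" "lambda_below T0 [2] 2 [1]" "lambda_below T0 [2] 2 [2]"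
  by code_simp+

lemma joined_centre:
  assumes "b \<in> binary_seqs"
  shows "real_of_int T0 / 10^12 < cf_lambda (joined b) 0" "cf_lambda (joined b) 0 < real_of_int T1 / 10^12"
  using lambda_above_sound[OF joined_pos[OF assms] joined_window[OF assms] centre_checks(1)]
    lambda_below_sound[OF joined_pos[OF assms] joined_window[OF assms] centre_checks(2)] by simp_all

lemma joined_off_centre:
  assumes b: "b \<in> binary_seqs" and "i \<noteq> 0"
  shows "cf_lambda (joined b) i < real_of_int T0 / 10^12"
proof -
  note pos = joined_pos[OF b]
  consider "i \<le> -16" | "i \<in> {-15..16}" | "i \<ge> 17" by fastforce
  then show ?thesis
  proof cases
    case 1
    then show ?thesis
      by (intro periodic_value_below[OF pos, of _ 0]) (simp add: joined_def)
  next
    case 2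
    have "i + int (nat (17 - i)) \<le> 17" using 2 by simp
    moreover have "finite_check i (nat (17 - i))" using 2 assms(2) by (rule finite_check_all)
    ultimately show ?thesis
      unfolding finite_check_def by (intro lambda_below_sound[OF pos joined_window[OF b]])
  next
    \<comment> \<open>From position 16 on only the digits 1 and 2 occur, and one known neighbour on
      each side is enough.\<close>
    case 3
    have d: "joined b j = 1 \<or> joined b j = 2" if j: "j \<ge> 16" for j
    proof -
      consider "j = 16" | "j = 17" | "j \<ge> 18" using j by linarith
      then show ?thesis using b by cases (auto simp: joined_def bridge_def binary_seqs_def)
    qed
    have "window (joined b) i [int (joined b (i - 1))] (int (joined b i)) [int (joined b (i + 1))]"
      using joined_le_3[OF b] by (simp add: window_def)
    moreover have "lambda_below T0 [int (joined b (i - 1))] (int (joined b i)) [int (joined b (i + 1))]"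
      using d[of "i - 1"] d[of i] d[of "i + 1"] 3 small_digit_checks by auto
    ultimately show ?thesis by (rule lambda_below_sound[OF pos])
  qed
qed

lemma joined_markov_value:
  assumes "b \<in> binary_seqs"
  shows "markov_value (joined b) = ereal (cf_lambda (joined b) 0)"
  unfolding markov_value_def
proof (rule antisym)
  have "cf_lambda (joined b) i \<le> cf_lambda (joined b) 0" for i
    using joined_off_centre[OF assms, of i] joined_centre(1)[OF assms] by (cases "i = 0") auto
  then show "(SUP n. ereal (cf_lambda (joined b) n)) \<le> ereal (cf_lambda (joined b) 0)"
    by (intro SUP_least) simp
qed (rule SUP_upper, simp)

lemma joined_in_difference:
  assumes "b \<in> binary_seqs"
  shows "cf_lambda (joined b) 0 \<in> (markov_spectrum - lagrange_spectrum) \<inter> {3.7<..<3.71}"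
proof -
  have "cf_lambda (joined b) 0 \<in> markov_spectrum"
    unfolding markov_spectrum_def using joined_markov_value[OF assms] joined_pos[OF assms] by blast
  moreover have "cf_lambda (joined b) 0 \<notin> lagrange_spectrum"
    using joined_centre[OF assms] by (intro lagrange_gap)
  ultimately show ?thesis using joined_centre[OF assms] by auto
qed

section \<open>Separation of the Markov values of different binary tails\<close>

lemma inverse_cf_right_eq_mobius:
  assumes "\<forall>i. a i > 0"
  shows "1 / cf_right a n = cf_mobius (map (\<lambda>k. a (n + 1 + int k)) [0..<l]) (1 / cf_right a (n + int l))"
proof (induction l arbitrary: n)
  case (Suc l)
  have "map (\<lambda>k. a (n + 1 + int k)) [0..<Suc l] = a (n + 1) # map (\<lambda>k. a (n + 1 + 1 + int k)) [0..<l]"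
    by (simp only: upt_conv_Cons map_Suc_upt[symmetric] zero_less_Suc) (simp add: add_ac)
  then show ?case
    using cf_right_rec[OF assms, of n] Suc.IH[of "n + 1"] by (simp add: add_ac)
qed simp

lemma cf_mobius_le_1:
  assumes "\<forall>d \<in> set w. d \<ge> 1" "0 < x" "x \<le> 1"
  shows "cf_mobius w x \<le> 1"
proof (cases w)
  case (Cons d v)
  then have "real d \<ge> 1" using assms(1) by auto
  then show ?thesis using cf_mobius_pos[OF assms(2), of v] by (simp add: Cons)
qed (use assms in simp)

lemma cf_denom_le:
  assumes "\<forall>d \<in> set w. d \<ge> 1 \<and> d \<le> 3" "0 < x" "x \<le> 1"
  shows "0 < cf_denom w x \<and> cf_denom w x \<le> 4 ^ length w"
  using assms(1)
proof (induction w)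
  case (Cons d w)
  have "cf_mobius w x \<le> 1" "cf_mobius w x > 0" "real d \<le> 3"
    using cf_mobius_le_1[of w x] cf_mobius_pos assms Cons.prems by auto
  then have "real d + cf_mobius w x \<le> 4" "real d + cf_mobius w x > 0" by auto
  then show ?case using Cons by (auto intro!: mult_mono)
qed simp

text \<open>Bootstrapping along the tails: \<open>r < 3\<close> gives \<open>1 / r > 1/3\<close>,
  hence \<open>r > 4/3\<close>, hence \<open>1 / r < 3/4\<close>, hence
  \<open>r < 11/4\<close>.\<close>

lemma joined_tail_mem:
  assumes "b \<in> binary_seqs"
  shows "1 / cf_right (joined b) (17 + int n) \<in> cf_interval"
proof -
  note pos = joined_pos[OF assms]
  have rec: "cf_right (joined b) (17 + int k) = real (b k) + 1 / cf_right (joined b) (17 + int (Suc k))" for k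
    using cf_right_rec[OF pos, of "17 + int k"] joined_tail[of b k] by (simp add: add_ac)
  have bk: "real (b k) \<ge> 1" "real (b k) \<le> 2" for k
    using assms by (auto simp: binary_seqs_def) (metis One_nat_def le_SucI le_refl numeral_2_eq_2 of_nat_1 of_nat_le_iff of_nat_numeral)+
  define r where "r k = cf_right (joined b) (17 + int k)" for k
  have gt: "r k > 1" for k using cf_right_gt_1[OF pos] by (simp add: r_def)
  have rec': "r k = real (b k) + 1 / r (Suc k)" for k using rec by (simp add: r_def)
  have "r k < 3" for k
    using rec'[of k] bk(2)[of k] gt[of "Suc k"] by (smt (verit) divide_less_eq_1_pos)
  then have inv: "1/3 < 1 / r k" for k using gt[of k] by (simp add: field_simps)
  have "r k > 4/3" for k using rec'[of k] bk(1)[of k] inv[of "Suc k"] by linarith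
  then have upper: "1 / r k < 3/4" for k using gt[of k] by (simp add: field_simps)
  have "r n < 11/4" using rec'[of n] bk(2)[of n] upper[of "Suc n"] by linarith
  then have "4/11 < 1 / r n" using gt[of n] by (simp add: field_simps)
  then show ?thesis using upper[of n] by (simp add: cf_interval_def r_def)
qed

text \<open>In the constant, \<open>1/7\<close> separates the tails at the first differing digit,
  \<open>9 = 3^2\<close> is the distortion of the common prefix, and \<open>4^34\<close> bounds the
  two denominators of the 17 bridge digits.\<close>

lemma joined_gap:
  assumes b: "b \<in> binary_seqs" "b' \<in> binary_seqs" and eq: "\<And>k. k < n \<Longrightarrow> b k = b' k" and "b n \<noteq> b' n"
  shows "1 / (63 * 4^34) / (cf_denom (initial b n) cf12.base)\<^sup>2 \<le>
    \<bar>cf_lambda (joined b) 0 - cf_lambda (joined b') 0\<bar>"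
proof -
  define tail where "tail c m = 1 / cf_right (joined c) (17 + int m)" for c m
  have mem: "tail b m \<in> cf_interval" "tail b' m \<in> cf_interval" for m
    using joined_tail_mem b by (auto simp: tail_def)
  have tail_rec: "tail c m = 1 / (real (c m) + tail c (Suc m))" if "c \<in> binary_seqs" for c m
    using cf_right_rec[OF joined_pos[OF that], of "17 + int m"] joined_tail[of c m]
    by (simp add: tail_def add_ac)
  define u where "u = initial b n"
  have u: "initial b' n = u" using eq by (auto simp: u_def intro: initial_cong[symmetric])
  have u12: "set u \<subseteq> {1, 2}" using set_initial[OF b(1)] by (simp add: u_def)
  have tail0: "tail c 0 = cf_mobius (initial c n) (tail c n)" if "c \<in> binary_seqs" for c
    using inverse_cf_right_eq_mobius[OF joined_pos[OF that], of 17 n]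
    by (simp add: tail_def initial_def joined_tail)
  have left: "cf_left (joined b) 0 = cf_left (joined b') 0"
    unfolding cf_left_def by (simp add: joined_def)
  have lam: "cf_lambda (joined c) 0 = 3 + cf_mobius bridge (tail c 0) + 1 / cf_left (joined c) 0"
    if "c \<in> binary_seqs" for c
  proof -
    have "map (\<lambda>k. joined c (0 + 1 + int k)) [0..<17] = bridge"
      by (rule nth_equalityI) (auto simp: bridge_def joined_def)
    then have "1 / cf_right (joined c) 0 = cf_mobius bridge (tail c 0)"
      using inverse_cf_right_eq_mobius[OF joined_pos[OF that], of 0 17] by (simp add: tail_def)
    moreover have "joined c 0 = 3" by (simp add: joined_def per_def)
    ultimately show ?thesis using cf_lambda_eq[OF joined_pos[OF that], of 0] by simp
  qed
  have pos: "tail b m > 0" "tail b' m > 0" "tail b m \<le> 1" "tail b' m \<le> 1" for m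
    using mem[of m] by (auto simp: cf_interval_def)
  define D where "D = cf_denom u cf12.base"
  have "D > 0" using cf_denom_pos[OF u12 cf12.base_mem] by (simp add: D_def)
  have du: "0 < cf_denom u (tail b n)" "cf_denom u (tail b n) \<le> 3 * D"
    "0 < cf_denom u (tail b' n)" "cf_denom u (tail b' n) \<le> 3 * D"
    using cf_denom_pos[OF u12] cf_denom_distortion[OF u12 _ cf12.base_mem] mem by (auto simp: D_def)
  have br: "\<forall>d \<in> set bridge. d \<ge> 1 \<and> d \<le> 3" "length bridge = 17" by (auto simp: bridge_def)
  have dbr: "0 < cf_denom bridge (tail b 0)" "cf_denom bridge (tail b 0) \<le> 4^17"
    "0 < cf_denom bridge (tail b' 0)" "cf_denom bridge (tail b' 0) \<le> 4^17"
    using cf_denom_le[OF br(1), of "tail b 0"] cf_denom_le[OF br(1), of "tail b' 0"] pos br(2) by auto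
  have separated: "1/7 \<le> \<bar>tail b n - tail b' n\<bar>"
  proof -
    have *: "1/7 \<le> 1 / (1 + y) - 1 / (2 + y')" if "y \<in> cf_interval" "y' \<in> cf_interval" for y y' :: real
    proof -
      have "4/7 \<le> 1 / (1 + y)" "1 / (2 + y') \<le> 11/26" using that by (auto simp: cf_interval_def field_simps)
      then show ?thesis by linarith
    qed
    have "(b n = 1 \<and> b' n = 2) \<or> (b n = 2 \<and> b' n = 1)"
      using b \<open>b n \<noteq> b' n\<close> by (auto simp: binary_seqs_def) (metis numeral_2_eq_2 One_nat_def)+
    then show ?thesis
      using *[OF mem(1)[of "Suc n"] mem(2)[of "Suc n"]] *[OF mem(2)[of "Suc n"] mem(1)[of "Suc n"]]
        tail_rec[OF b(1), of n] tail_rec[OF b(2), of n] by auto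
  qed
  have "1/7 / (9 * D^2) \<le> \<bar>tail b n - tail b' n\<bar> / (cf_denom u (tail b n) * cf_denom u (tail b' n))"
  proof (rule frac_le)
    show "cf_denom u (tail b n) * cf_denom u (tail b' n) \<le> 9 * D\<^sup>2"
      using mult_mono[OF du(2,4)] du \<open>D > 0\<close> by (simp add: power2_eq_square)
  qed (use separated du in auto)
  also have "\<dots> = \<bar>tail b 0 - tail b' 0\<bar>"
    unfolding tail0[OF b(1)] tail0[OF b(2)] u u_def[symmetric] by (rule cf_mobius_diff[symmetric]) (rule pos)+
  finally have 1: "1/7 / (9 * D^2) \<le> \<bar>tail b 0 - tail b' 0\<bar>" .
  have "1/7 / (9 * D^2) / 4^34 \<le>
      \<bar>tail b 0 - tail b' 0\<bar> / (cf_denom bridge (tail b 0) * cf_denom bridge (tail b' 0))"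
  proof (rule frac_le)
    show "cf_denom bridge (tail b 0) * cf_denom bridge (tail b' 0) \<le> 4 ^ 34"
      using mult_mono[OF dbr(2,4)] dbr by simp
  qed (use 1 dbr in auto)
  also have "\<dots> = \<bar>cf_mobius bridge (tail b 0) - cf_mobius bridge (tail b' 0)\<bar>"
    by (rule cf_mobius_diff[symmetric]) (rule pos)+
  also have "\<dots> = \<bar>cf_lambda (joined b) 0 - cf_lambda (joined b') 0\<bar>"
    unfolding lam[OF b(1)] lam[OF b(2)] left by simp
  finally show ?thesis by (simp add: D_def u_def)
qed

theorem theorem1p1:
  shows "hausdorff_dimension ((markov_spectrum - lagrange_spectrum) \<inter> {3.7<..<3.71}) > ereal 0.53128
    \<and> (markov_spectrum - lagrange_spectrum) \<inter> {3.7<..<3.71} \<noteq> {}"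
proof
  have "hausdorff_dimension ((markov_spectrum - lagrange_spectrum) \<inter> {3.7<..<3.71}) \<ge> ereal (552/1039)"
    using joined_in_difference
    by (intro cf12.hausdorff_dimension_image_ge[OF _ joined_gap]) auto
  \<comment> \<open>The margin is only about \<open>8 * 10^-8\<close>; the exponent has to stay
    below the dimension \<open>0.5312805...\<close> of the Cantor set.\<close>
  moreover have "ereal 0.53128 < ereal (552/1039)" by simp
  ultimately show "hausdorff_dimension ((markov_spectrum - lagrange_spectrum) \<inter> {3.7<..<3.71}) > ereal 0.53128"
    by (rule less_le_trans[rotated])
  have "(\<lambda>_. 1) \<in> binary_seqs" by (simp add: binary_seqs_def)
  from joined_in_difference[OF this]
  show "(markov_spectrum - lagrange_spectrum) \<inter> {3.7<..<3.71} \<noteq> {}" by blast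
qed

end
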